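(* Let $a,b,c$ be unlabeled graph combinations such that $b\neq0$, and $b$ and $c$ are sos-testable. If $ab=c$, then $a$ is sos-testable.
   Context: Graphs are finite, simple. $t(H;G)$ is the probability that a uniformly random map $V(H)\to V(G)$ maps edges to edges. A partially labeled graph is a graph without isolated vertices in which some vertices receive distinct labels from $\{1,2,\ldots\}$ (unlabeled if none); the empty graph is $1$. A graph combination is a finite formal $\mathbb R$-linear combination of partially labeled graphs; the product glues vertices with equal labels keeping one copy of doubled edges (for unlabeled graphs it is disjoint union), extended bilinearly; $[[\cdot]]$ removes all labels. For unlabeled $a=\sum\alpha_iH_i$, $a(G)=\sum\alpha_it(H_i;G)$. A $d$-sos graph combination is $\sum_j[[a_j^2]]$ where every constituent graph of every $a_j$ has at most $d$ edges. Fix $\ell(d)$ such that every $d$-sos combination can be written using labels only in $\{1,\ldots,\ell(d)\}$. $\mathcal B_d$: $1$ and all partially labeled graphs with labels in $\{1,\ldots,\ell(d)\}$, at most $d$ edges, no isolated vertices; $\mathcal V_d=\{[[AB]]\text{ connected}: A,B\in\mathcal B_d\}\setminus\{1\}$, $s=|\mathcal V_d|$. An unlabeled graph all of whose components lie in $\mathcal V_d$ is the monomial $\prod x_C$ over its components, evaluated at $\mathbf v\in\mathbb{R}^s$ by $x_C\mapsto v_C$; $d$-sos combinations are such polynomials. The $d$-sos-profile is $\mathcal S_d=\{\mathbf v\in\mathbb{R}^s_{\ge0}: a(\mathbf v)\ge0$ for every $d$-sos graph combination $a\}$. An unlabeled graph combination $a$ is sos-testable if for some $d$ (with all connected components of constituent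 graphs of $a$ in $\mathcal V_d$) we have $a(\mathbf v)\ge0$ for all $\mathbf v\in\mathcal S_d$. *)

theory Defs
  imports Complex_Main "HOL-Library.Poly_Mapping" "HOL-Library.Multiset" "HOL-Library.FuncSet"
begin

section \<open>Partially labeled graphs\<close>

text \<open>
  A vertex is either the (unique) vertex carrying the label \<open>n\<close>, written \<open>Lab n\<close>, or an
  unlabeled vertex \<open>Unl n\<close> whose index \<open>n\<close> is irrelevant up to isomorphism.  Since there
  are no isolated vertices, a graph is given by its edge set \<open>E\<close>; its vertex set is \<open>\<Union>E\<close>.
\<close>

datatype vert = Lab nat | Unl nat

definition is_plgraph :: "vert set set \<Rightarrow> bool" where
  "is_plgraph E \<longleftrightarrow> finite E \<and> (\<forall>e\<in>E. card e = 2 \<and> Lab 0 \<notin> e)"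

definition plgraph_iso :: "vert set set \<Rightarrow> vert set set \<Rightarrow> bool" where
  "plgraph_iso E F \<longleftrightarrow> is_plgraph E \<and> is_plgraph F \<and>
     (\<exists>f. inj_on f (\<Union>E) \<and> (\<forall>x\<in>\<Union>E. \<forall>n. f x = Lab n \<longleftrightarrow> x = Lab n) \<and> F = (`) f ` E)"

lemma plgraph_isoI:
  assumes E: "is_plgraph E" and inj: "inj_on f (\<Union>E)"
    and lab: "\<And>x n. x \<in> \<Union>E \<Longrightarrow> f x = Lab n \<longleftrightarrow> x = Lab n"
    and F: "F = (`) f ` E"
  shows "plgraph_iso E F"
proof -
  have "card (f ` e) = 2 \<and> Lab 0 \<notin> f ` e" if "e \<in> E" for e
  proof -
    have "inj_on f e" using inj that by (meson Union_upper inj_on_subset)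
    moreover have "card e = 2" "Lab 0 \<notin> e" using E that by (auto simp: is_plgraph_def)
    moreover have "Lab 0 \<notin> f ` e" using lab that \<open>Lab 0 \<notin> e\<close> by (metis UnionI imageE)
    ultimately show ?thesis by (simp add: card_image)
  qed
  then have "is_plgraph F" using E by (auto simp: is_plgraph_def F)
  then show ?thesis unfolding plgraph_iso_def using assms by blast
qed

lemma plgraph_isoE:
  assumes "plgraph_iso E F"
  obtains f where "is_plgraph E" "is_plgraph F" "inj_on f (\<Union>E)"
    "\<And>x n. x \<in> \<Union>E \<Longrightarrow> f x = Lab n \<longleftrightarrow> x = Lab n" "F = (`) f ` E"
  using assms unfolding plgraph_iso_def by blast

lemma plgraph_iso_refl: "is_plgraph E \<Longrightarrow> plgraph_iso E E"
  by (rule plgraph_isoI[where f = "\<lambda>x. x"]) auto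

lemma plgraph_iso_sym: "plgraph_iso E F \<Longrightarrow> plgraph_iso F E"
proof (erule plgraph_isoE)
  fix f
  assume E: "is_plgraph E" and Fg: "is_plgraph F" and inj: "inj_on f (\<Union>E)"
    and lab: "\<And>x n. x \<in> \<Union>E \<Longrightarrow> f x = Lab n \<longleftrightarrow> x = Lab n" and F: "F = (`) f ` E"
  let ?g = "inv_into (\<Union>E) f"
  have UF: "\<Union>F = f ` \<Union>E" unfolding F by blast
  have "?g ` f ` e = e" if "e \<in> E" for e
    using that inj by (simp add: Union_upper inv_into_image_cancel)
  then have "(`) ?g ` F = E" by (force simp: F image_iff)
  moreover have "?g x = Lab n \<longleftrightarrow> x = Lab n" if x: "x \<in> \<Union>F" for x n
  proof -
    obtain y where y: "y \<in> \<Union>E" "x = f y" using x UF by blast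
    then have "?g x = y" using inj by simp
    then show ?thesis using lab y by simp
  qed
  moreover have "inj_on ?g (\<Union>F)" by (simp add: UF inj_on_inv_into)
  ultimately show ?thesis using plgraph_isoI[OF Fg, of ?g E] by simp
qed

lemma plgraph_iso_trans:
  assumes "plgraph_iso E F" "plgraph_iso F G"
  shows "plgraph_iso E G"
proof -
  obtain f where f: "is_plgraph E" "inj_on f (\<Union>E)"
    "\<And>x n. x \<in> \<Union>E \<Longrightarrow> f x = Lab n \<longleftrightarrow> x = Lab n" "F = (`) f ` E"
    using assms(1) by (rule plgraph_isoE) blast
  obtain g where g: "inj_on g (\<Union>F)"
    "\<And>x n. x \<in> \<Union>F \<Longrightarrow> g x = Lab n \<longleftrightarrow> x = Lab n" "G = (`) g ` F"
    using assms(2) by (rule plgraph_isoE) blast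
  have UF: "\<Union>F = f ` \<Union>E" unfolding f(4) by blast
  show ?thesis
  proof (rule plgraph_isoI[OF f(1)])
    show "inj_on (g \<circ> f) (\<Union>E)" using f(2) g(1) UF by (simp add: comp_inj_on)
    show "(g \<circ> f) x = Lab n \<longleftrightarrow> x = Lab n" if "x \<in> \<Union>E" for x n
      using f(3)[OF that] g(2)[of "f x"] UF that by simp
    show "G = (`) (g \<circ> f) ` E" by (simp add: g(3) f(4) image_image)
  qed
qed

text \<open>Partially labeled graphs, taken up to label-preserving isomorphism.\<close>

quotient_type plgraph = "vert set set" / partial: plgraph_iso
proof (rule part_equivpI)
  show "\<exists>E. plgraph_iso E E"
    by (rule exI[of _ "{}"], rule plgraph_iso_refl) (simp add: is_plgraph_def)
  show "symp plgraph_iso" by (rule sympI) (rule plgraph_iso_sym)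
  show "transp plgraph_iso" by (rule transpI) (rule plgraph_iso_trans)
qed

lift_definition num_edges :: "plgraph \<Rightarrow> nat" is card
proof (erule plgraph_isoE)
  fix E F :: "vert set set" and f
  assume inj: "inj_on f (\<Union>E)" and F: "F = (`) f ` E"
  have "inj_on ((`) f) E"
    by (rule inj_onI) (metis Union_upper inj inj_on_image_eq_iff)
  then show "card E = card F" by (simp add: F card_image)
qed

lift_definition labels :: "plgraph \<Rightarrow> nat set" is "\<lambda>E. {n. Lab n \<in> \<Union>E}"
proof (erule plgraph_isoE)
  fix E F :: "vert set set" and f
  assume lab: "\<And>x n. x \<in> \<Union>E \<Longrightarrow> f x = Lab n \<longleftrightarrow> x = Lab n" and F: "F = (`) f ` E"
  have UF: "\<Union>F = f ` \<Union>E" unfolding F by blast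
  show "{n. Lab n \<in> \<Union>E} = {n. Lab n \<in> \<Union>F}"
    unfolding UF using lab by (metis (no_types, lifting) image_iff)
qed

definition unlabeled :: "plgraph \<Rightarrow> bool" where
  "unlabeled G \<longleftrightarrow> labels G = {}"

text \<open>The map \<open>[[\<cdot>]]\<close> on graphs: all vertices, renamed injectively, become unlabeled.\<close>

fun drop_label :: "vert \<Rightarrow> vert" where
  "drop_label (Lab n) = Unl (2 * n)"
| "drop_label (Unl n) = Unl (2 * n + 1)"

lemma drop_label_eq_iff [simp]: "drop_label x = drop_label y \<longleftrightarrow> x = y"
  by (cases x; cases y; simp; presburger)

lemma drop_label_neq_Lab [simp]: "drop_label x \<noteq> Lab n"
  by (cases x) auto

lemma is_plgraph_image:
  assumes "is_plgraph E" "inj_on f (\<Union>E)" "Lab 0 \<notin> f ` \<Union>E"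
  shows "is_plgraph ((`) f ` E)"
proof -
  have "card (f ` e) = 2" if "e \<in> E" for e
    using assms that by (metis Union_upper card_image inj_on_subset is_plgraph_def)
  then show ?thesis using assms by (auto simp: is_plgraph_def)
qed

lift_definition unlabel :: "plgraph \<Rightarrow> plgraph" is "\<lambda>E. (`) drop_label ` E"
proof (erule plgraph_isoE)
  fix E F :: "vert set set" and f
  assume E: "is_plgraph E" and inj: "inj_on f (\<Union>E)" and F: "F = (`) f ` E"
  let ?g = "drop_label \<circ> f \<circ> inv drop_label"
  have d: "inj drop_label" by (simp add: inj_on_def)
  have U: "\<Union>((`) drop_label ` E) = drop_label ` \<Union>E" by blast
  show "plgraph_iso ((`) drop_label ` E) ((`) drop_label ` F)"
  proof (rule plgraph_isoI[where f = ?g])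
    show "is_plgraph ((`) drop_label ` E)"
      by (rule is_plgraph_image[OF E]) (auto simp: inj_on_def, metis drop_label_neq_Lab)
    show "inj_on ?g (\<Union>((`) drop_label ` E))"
      unfolding U using inj by (auto simp: inj_on_def d)
    show "?g x = Lab n \<longleftrightarrow> x = Lab n" if "x \<in> \<Union>((`) drop_label ` E)" for x n
      using that unfolding U by auto
    show "(`) drop_label ` F = (`) ?g ` (`) drop_label ` E"
      by (simp add: F image_image d)
  qed
qed

subsection \<open>Product\<close>

text \<open>
  The product glues equal labels: the unlabeled vertices are made disjoint, whereas vertices
  with equal labels (and edges between them) coincide in the union.
\<close>

fun shiftL :: "vert \<Rightarrow> vert" where
  "shiftL (Lab n) = Lab n"
| "shiftL (Unl n) = Unl (2 * n)"

fun shiftR :: "vert \<Rightarrow> vert" where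
  "shiftR (Lab n) = Lab n"
| "shiftR (Unl n) = Unl (2 * n + 1)"

definition glue :: "vert set set \<Rightarrow> vert set set \<Rightarrow> vert set set" where
  "glue E F = (`) shiftL ` E \<union> (`) shiftR ` F"

lemma shift_eq_iff [simp]:
  "shiftL x = shiftL y \<longleftrightarrow> x = y" "shiftR x = shiftR y \<longleftrightarrow> x = y"
  "shiftL x = Lab n \<longleftrightarrow> x = Lab n" "shiftR x = Lab n \<longleftrightarrow> x = Lab n"
  "Lab n = shiftL x \<longleftrightarrow> x = Lab n" "Lab n = shiftR x \<longleftrightarrow> x = Lab n"
  by (cases x; cases y; auto)+

lemma shiftL_eq_shiftR_iff: "shiftL x = shiftR y \<longleftrightarrow> (\<exists>n. x = Lab n \<and> y = Lab n)"
  by (cases x; cases y; simp; presburger)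

lemma shiftR_eq_shiftL_iff: "shiftR x = shiftL y \<longleftrightarrow> (\<exists>n. x = Lab n \<and> y = Lab n)"
  by (metis shiftL_eq_shiftR_iff)

lemma shiftL_or_shiftR: "(\<exists>u. z = shiftL u) \<or> (\<exists>u. z = shiftR u)"
proof (cases z)
  case (Lab n)
  then have "z = shiftL (Lab n)" by simp
  then show ?thesis by blast
next
  case (Unl n)
  then have "z = shiftL (Unl (n div 2)) \<or> z = shiftR (Unl (n div 2))"
    by (cases "even n") auto
  then show ?thesis by blast
qed

lemma Union_glue: "\<Union>(glue E F) = shiftL ` \<Union>E \<union> shiftR ` \<Union>F"
  by (auto simp: glue_def)

lemma is_plgraph_Un: "is_plgraph E \<Longrightarrow> is_plgraph F \<Longrightarrow> is_plgraph (E \<union> F)"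
  by (auto simp: is_plgraph_def)

lemma is_plgraph_Lab0: "is_plgraph E \<Longrightarrow> Lab 0 \<notin> \<Union>E"
  by (auto simp: is_plgraph_def)

lemma is_plgraph_glue: "is_plgraph E \<Longrightarrow> is_plgraph F \<Longrightarrow> is_plgraph (glue E F)"
  unfolding glue_def
  by (intro is_plgraph_Un is_plgraph_image) (auto simp: inj_on_def dest: is_plgraph_Lab0)

lemma glue_cong:
  assumes "plgraph_iso E E'" "plgraph_iso F F'"
  shows "plgraph_iso (glue E F) (glue E' F')"
proof -
  obtain f where f: "is_plgraph E" "inj_on f (\<Union>E)"
    "\<And>x n. x \<in> \<Union>E \<Longrightarrow> f x = Lab n \<longleftrightarrow> x = Lab n" "E' = (`) f ` E"
    using assms(1) by (rule plgraph_isoE) blast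
  obtain g where g: "is_plgraph F" "inj_on g (\<Union>F)"
    "\<And>x n. x \<in> \<Union>F \<Longrightarrow> g x = Lab n \<longleftrightarrow> x = Lab n" "F' = (`) g ` F"
    using assms(2) by (rule plgraph_isoE) blast
  define h where "h x = (case x of Lab n \<Rightarrow> Lab n
    | Unl n \<Rightarrow> if even n then shiftL (f (Unl (n div 2))) else shiftR (g (Unl (n div 2))))" for x
  have hL: "h (shiftL x) = shiftL (f x)" if "x \<in> \<Union>E" for x
    using f(3)[OF that] by (cases x) (auto simp: h_def)
  have hR: "h (shiftR x) = shiftR (g x)" if "x \<in> \<Union>F" for x
    using g(3)[OF that] by (cases x) (auto simp: h_def)
  show ?thesis
  proof (rule plgraph_isoI[OF is_plgraph_glue[OF f(1) g(1)]])
    show "inj_on h (\<Union>(glue E F))"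
    proof (rule inj_onI)
      fix x y assume x: "x \<in> \<Union>(glue E F)" and y: "y \<in> \<Union>(glue E F)" and eq: "h x = h y"
      have "(\<exists>a\<in>\<Union>E. x = shiftL a) \<or> (\<exists>a\<in>\<Union>F. x = shiftR a)" using x by (auto simp: Union_glue)
      moreover have "(\<exists>a\<in>\<Union>E. y = shiftL a) \<or> (\<exists>a\<in>\<Union>F. y = shiftR a)"
        using y by (auto simp: Union_glue)
      moreover have "x = y" if "a \<in> \<Union>E" "x = shiftL a" "b \<in> \<Union>E" "y = shiftL b" for a b
        using that eq hL f(2) by (metis inj_onD shift_eq_iff(1))
      moreover have "x = y" if "a \<in> \<Union>F" "x = shiftR a" "b \<in> \<Union>F" "y = shiftR b" for a b
        using that eq hR g(2) by (metis inj_onD shift_eq_iff(2))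
      moreover have "x = y" if "a \<in> \<Union>E" "x = shiftL a" "b \<in> \<Union>F" "y = shiftR b" for a b
        using that eq hL hR f(3) g(3) by (metis shiftL.simps(1) shiftL_eq_shiftR_iff shiftR.simps(1))
      moreover have "x = y" if "a \<in> \<Union>F" "x = shiftR a" "b \<in> \<Union>E" "y = shiftL b" for a b
        using that eq hL hR f(3) g(3) by (metis shiftL.simps(1) shiftL_eq_shiftR_iff shiftR.simps(1))
      ultimately show "x = y" by blast
    qed
    show "h x = Lab n \<longleftrightarrow> x = Lab n" if "x \<in> \<Union>(glue E F)" for x n
    proof -
      have "(\<exists>a\<in>\<Union>E. x = shiftL a) \<or> (\<exists>a\<in>\<Union>F. x = shiftR a)" using that by (auto simp: Union_glue)
      then show ?thesis
      proof
        assume "\<exists>a\<in>\<Union>E. x = shiftL a"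
        then obtain a where "a \<in> \<Union>E" "x = shiftL a" by blast
        then show ?thesis by (simp only: hL shift_eq_iff f(3))
      next
        assume "\<exists>a\<in>\<Union>F. x = shiftR a"
        then obtain a where "a \<in> \<Union>F" "x = shiftR a" by blast
        then show ?thesis by (simp only: hR shift_eq_iff g(3))
      qed
    qed
    have "h ` shiftL ` e = shiftL ` f ` e" if "e \<in> E" for e
      using that by (force simp: image_image intro!: image_cong hL)
    moreover have "h ` shiftR ` e = shiftR ` g ` e" if "e \<in> F" for e
      using that by (force simp: image_image intro!: image_cong hR)
    ultimately show "glue E' F' = (`) h ` glue E F"
      by (simp add: glue_def f(4) g(4) image_Un image_image cong: image_cong_simp)
  qed
qed

text \<open>
  The monoid of partially labeled graphs under the product is written additively (the empty
  graph being \<open>0\<close>), so that the convolution product of \<open>plgraph \<Rightarrow>\<^sub>0 real\<close> is the bilinear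
  extension of the product of graphs.
\<close>

instantiation plgraph :: comm_monoid_add
begin

lift_definition zero_plgraph :: plgraph is "{}"
  by (rule plgraph_iso_refl) (simp add: is_plgraph_def)

lift_definition plus_plgraph :: "plgraph \<Rightarrow> plgraph \<Rightarrow> plgraph" is glue
  by (rule glue_cong)

instance
proof
  fix a b c :: plgraph
  show "a + b + c = a + (b + c)"
  proof transfer
    fix E F G assume "plgraph_iso E E" "plgraph_iso F F" "plgraph_iso G G"
    then have "is_plgraph E" "is_plgraph F" "is_plgraph G" by (auto simp: plgraph_iso_def)
    define h where "h x = (case x of Lab n \<Rightarrow> Lab n
      | Unl n \<Rightarrow> if odd n then Unl (2 * n + 1)
          else if even (n div 2) then Unl (n div 2) else Unl (n - 1))" for x
    have "h (shiftL (shiftL x)) = shiftL x" "h (shiftL (shiftR x)) = shiftR (shiftL x)"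
      "h (shiftR x) = shiftR (shiftR x)" for x
      by (cases x; simp add: h_def)+
    note h = this
    show "plgraph_iso (glue (glue E F) G) (glue E (glue F G))"
    proof (rule plgraph_isoI)
      show "is_plgraph (glue (glue E F) G)" by (intro is_plgraph_glue) fact+
      have "inj h"
      proof (rule injI)
        fix x y assume eq: "h x = h y"
        have "(\<exists>u. z = shiftL (shiftL u)) \<or> (\<exists>u. z = shiftL (shiftR u)) \<or> (\<exists>u. z = shiftR u)" for z
          by (metis shiftL_or_shiftR)
        from this[of x] this[of y] eq show "x = y"
          by (elim disjE exE) (auto simp: h shiftL_eq_shiftR_iff shiftR_eq_shiftL_iff)
      qed
      then show "inj_on h (\<Union>(glue (glue E F) G))" by (rule inj_on_subset) simp
      show "h x = Lab n \<longleftrightarrow> x = Lab n" for x n by (cases x) (auto simp: h_def)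
      show "glue E (glue F G) = (`) h ` glue (glue E F) G"
        by (simp add: glue_def image_Un image_image h Un_assoc)
    qed
  qed
  show "a + b = b + a"
  proof transfer
    fix E F assume "plgraph_iso E E" "plgraph_iso F F"
    then have "is_plgraph E" "is_plgraph F" by (auto simp: plgraph_iso_def)
    define h where "h x = (case x of Lab n \<Rightarrow> Lab n
      | Unl n \<Rightarrow> if odd n then Unl (n - 1) else Unl (n + 1))" for x
    have h: "h (shiftL x) = shiftR x" "h (shiftR x) = shiftL x" for x
      by (cases x; simp add: h_def)+
    show "plgraph_iso (glue E F) (glue F E)"
    proof (rule plgraph_isoI)
      show "is_plgraph (glue E F)" by (intro is_plgraph_glue) fact+
      have "inj h"
      proof (rule injI)
        fix x y assume "h x = h y"
        with shiftL_or_shiftR[of x] shiftL_or_shiftR[of y] show "x = y"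
          by (auto simp: h shiftL_eq_shiftR_iff shiftR_eq_shiftL_iff)
      qed
      then show "inj_on h (\<Union>(glue E F))" by (rule inj_on_subset) simp
      show "h x = Lab n \<longleftrightarrow> x = Lab n" for x n by (cases x) (auto simp: h_def)
      show "glue F E = (`) h ` glue E F"
        by (simp add: glue_def image_Un image_image h Un_commute)
    qed
  qed
  show "0 + a = a"
  proof transfer
    fix E assume "plgraph_iso E E"
    then have "is_plgraph E" by (auto simp: plgraph_iso_def)
    then have "plgraph_iso E (glue {} E)"
      by (rule plgraph_isoI[where f = shiftR]) (auto simp: glue_def inj_on_def)
    then show "plgraph_iso (glue {} E) E" by (rule plgraph_iso_sym)
  qed
qed

end

subsection \<open>Connected components\<close>

definition adj :: "vert set set \<Rightarrow> vert rel" where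
  "adj E = {(u, v). {u, v} \<in> E}"

definition edge_components :: "vert set set \<Rightarrow> vert set set set" where
  "edge_components E = (\<lambda>W. {e \<in> E. e \<subseteq> W}) ` (\<Union>E // (adj E)\<^sup>*)"

lemma adj_rtrancl_image:
  assumes "(u, v) \<in> (adj E)\<^sup>*"
  shows "(f u, f v) \<in> (adj ((`) f ` E))\<^sup>*"
  using assms
proof (induction rule: rtrancl_induct)
  case (step y z)
  then have "f ` {y, z} \<in> (`) f ` E" unfolding adj_def by blast
  then have "(f y, f z) \<in> adj ((`) f ` E)" by (simp add: adj_def)
  with step.IH show ?case by (rule rtrancl_into_rtrancl)
qed simp

lemma adj_rtrancl_closed: "(u, v) \<in> (adj E)\<^sup>* \<Longrightarrow> u \<in> \<Union>E \<Longrightarrow> v \<in> \<Union>E"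
  by (induction rule: rtrancl_induct) (auto simp: adj_def)

lemma adj_rtrancl_image_iff:
  assumes "inj_on f (\<Union>E)" "u \<in> \<Union>E" "v \<in> \<Union>E"
  shows "(f u, f v) \<in> (adj ((`) f ` E))\<^sup>* \<longleftrightarrow> (u, v) \<in> (adj E)\<^sup>*"
proof
  assume "(f u, f v) \<in> (adj ((`) f ` E))\<^sup>*"
  then have "(inv_into (\<Union>E) f (f u), inv_into (\<Union>E) f (f v))
      \<in> (adj ((`) (inv_into (\<Union>E) f) ` (`) f ` E))\<^sup>*"
    by (rule adj_rtrancl_image)
  moreover have "(`) (inv_into (\<Union>E) f) ` (`) f ` E = E"
  proof -
    have "inv_into (\<Union>E) f ` f ` e = e" if "e \<in> E" for e
      using that assms(1) by (simp add: Union_upper inv_into_image_cancel)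
    then show ?thesis by (force simp: image_iff)
  qed
  ultimately show "(u, v) \<in> (adj E)\<^sup>*" using assms by simp
qed (rule adj_rtrancl_image)

lift_definition connected_graph :: "plgraph \<Rightarrow> bool" is
  "\<lambda>E. \<forall>u\<in>\<Union>E. \<forall>v\<in>\<Union>E. (u, v) \<in> (adj E)\<^sup>*"
proof (erule plgraph_isoE)
  fix E F :: "vert set set" and f
  assume inj: "inj_on f (\<Union>E)" and F: "F = (`) f ` E"
  have UF: "\<Union>F = f ` \<Union>E" unfolding F by blast
  show "(\<forall>u\<in>\<Union>E. \<forall>v\<in>\<Union>E. (u, v) \<in> (adj E)\<^sup>*) = (\<forall>u\<in>\<Union>F. \<forall>v\<in>\<Union>F. (u, v) \<in> (adj F)\<^sup>*)"
    unfolding UF unfolding F using adj_rtrancl_image_iff[OF inj] by blast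
qed

lemma edge_components_image:
  assumes inj: "inj_on f (\<Union>E)"
  shows "edge_components ((`) f ` E) = (\<lambda>C. (`) f ` C) ` edge_components E"
proof -
  let ?F = "(`) f ` E"
  have UF: "\<Union>?F = f ` \<Union>E" by blast
  have cls: "(adj ?F)\<^sup>* `` {f u} = f ` ((adj E)\<^sup>* `` {u})" if u: "u \<in> \<Union>E" for u
  proof (intro set_eqI iffI)
    fix y assume "y \<in> (adj ?F)\<^sup>* `` {f u}"
    then have r: "(f u, y) \<in> (adj ?F)\<^sup>*" by simp
    then have "y \<in> f ` \<Union>E" using adj_rtrancl_closed[OF r] u UF by blast
    then obtain v where v: "v \<in> \<Union>E" "y = f v" by blast
    with r have "(u, v) \<in> (adj E)\<^sup>*" using adj_rtrancl_image_iff[OF inj u] by simp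
    then show "y \<in> f ` ((adj E)\<^sup>* `` {u})" using v by blast
  next
    fix y assume "y \<in> f ` ((adj E)\<^sup>* `` {u})"
    then show "y \<in> (adj ?F)\<^sup>* `` {f u}" using adj_rtrancl_image[of u _ E f] by blast
  qed
  have ed: "{e \<in> ?F. e \<subseteq> f ` W} = (`) f ` {e \<in> E. e \<subseteq> W}" if W: "W \<subseteq> \<Union>E" for W
  proof -
    have "f ` e \<subseteq> f ` W \<longleftrightarrow> e \<subseteq> W" if "e \<in> E" for e
      using inj_on_image_mem_iff[OF inj _ W] that by blast
    then show ?thesis by blast
  qed
  have "edge_components ?F = (\<lambda>u. {e \<in> ?F. e \<subseteq> (adj ?F)\<^sup>* `` {f u}}) ` \<Union>E"
    unfolding edge_components_def quotient_def UF by blast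
  also have "\<dots> = (\<lambda>u. (`) f ` {e \<in> E. e \<subseteq> (adj E)\<^sup>* `` {u}}) ` \<Union>E"
  proof (rule image_cong[OF refl])
    fix u assume u: "u \<in> \<Union>E"
    then have "(adj E)\<^sup>* `` {u} \<subseteq> \<Union>E" using adj_rtrancl_closed by blast
    then show "{e \<in> ?F. e \<subseteq> (adj ?F)\<^sup>* `` {f u}} = (`) f ` {e \<in> E. e \<subseteq> (adj E)\<^sup>* `` {u}}"
      by (simp only: cls[OF u] ed)
  qed
  also have "\<dots> = (\<lambda>C. (`) f ` C) ` edge_components E"
    unfolding edge_components_def quotient_def by blast
  finally show ?thesis .
qed

lift_definition components :: "plgraph \<Rightarrow> plgraph multiset" is
  "\<lambda>E. image_mset abs_plgraph (mset_set (edge_components E))"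
proof (erule plgraph_isoE)
  fix E F :: "vert set set" and f
  assume E: "is_plgraph E" and inj: "inj_on f (\<Union>E)" and F: "F = (`) f ` E"
    and lab: "\<And>x n. x \<in> \<Union>E \<Longrightarrow> f x = Lab n \<longleftrightarrow> x = Lab n"
  let ?g = "\<lambda>C. (`) f ` C"
  have sub: "C \<subseteq> E" if "C \<in> edge_components E" for C
    using that by (auto simp: edge_components_def)
  have "inj_on ((`) f) E"
    by (rule inj_onI) (metis Union_upper inj inj_on_image_eq_iff)
  then have "inj_on ?g (edge_components E)"
    by (intro inj_onI) (metis sub inj_on_image_eq_iff)
  then have "mset_set (edge_components F) = image_mset ?g (mset_set (edge_components E))"
    by (simp add: F edge_components_image[OF inj] image_mset_mset_set)
  moreover have "abs_plgraph (?g C) = abs_plgraph C" if C: "C \<in> edge_components E" for C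
  proof -
    have *: "is_plgraph C" using E sub[OF C] finite_subset by (auto simp: is_plgraph_def)
    have UC: "\<Union>C \<subseteq> \<Union>E" using sub[OF C] by blast
    have "plgraph_iso C (?g C)"
    proof (rule plgraph_isoI[OF *])
      show "inj_on f (\<Union>C)" using inj UC by (rule inj_on_subset)
      show "f x = Lab n \<longleftrightarrow> x = Lab n" if "x \<in> \<Union>C" for x n
        using lab UC that by blast
    qed simp
    then show ?thesis using Quotient3_rel_abs[OF Quotient3_plgraph] by metis
  qed
  moreover have "finite (edge_components E)"
  proof (rule finite_subset)
    show "edge_components E \<subseteq> Pow E" using sub by blast
    show "finite (Pow E)" using E by (simp add: is_plgraph_def)
  qed
  ultimately show "image_mset abs_plgraph (mset_set (edge_components E))
      = image_mset abs_plgraph (mset_set (edge_components F))"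
    by (auto simp: image_mset.compositionality intro!: image_mset_cong)
qed

section \<open>Graph combinations\<close>

type_synonym graph_comb = "plgraph \<Rightarrow>\<^sub>0 real"

definition unlabeled_comb :: "graph_comb \<Rightarrow> bool" where
  "unlabeled_comb a \<longleftrightarrow> (\<forall>G\<in>Poly_Mapping.keys a. unlabeled G)"

definition unlabel_comb :: "graph_comb \<Rightarrow> graph_comb" where
  "unlabel_comb a =
     (\<Sum>G\<in>Poly_Mapping.keys a. Poly_Mapping.single (unlabel G) (Poly_Mapping.lookup a G))"

definition is_sos :: "nat \<Rightarrow> graph_comb \<Rightarrow> bool" where
  "is_sos d s \<longleftrightarrow> (\<exists>as :: graph_comb list.
     (\<forall>a\<in>set as. \<forall>G\<in>Poly_Mapping.keys a. num_edges G \<le> d) \<and>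
     s = (\<Sum>a\<leftarrow>as. unlabel_comb (a\<^sup>2)))"

definition is_sos_labels :: "nat \<Rightarrow> nat \<Rightarrow> graph_comb \<Rightarrow> bool" where
  "is_sos_labels l d s \<longleftrightarrow> (\<exists>as :: graph_comb list.
     (\<forall>a\<in>set as. \<forall>G\<in>Poly_Mapping.keys a. num_edges G \<le> d \<and> labels G \<subseteq> {1..l}) \<and>
     s = (\<Sum>a\<leftarrow>as. unlabel_comb (a\<^sup>2)))"

definition label_bound :: "(nat \<Rightarrow> nat) \<Rightarrow> bool" where
  "label_bound l \<longleftrightarrow> (\<forall>d s. is_sos d s \<longrightarrow> is_sos_labels (l d) d s)"

section \<open>Profiles and testability\<close>

definition \<B> :: "(nat \<Rightarrow> nat) \<Rightarrow> nat \<Rightarrow> plgraph set" where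
  "\<B> l d = {G. labels G \<subseteq> {1..l d} \<and> num_edges G \<le> d}"

text \<open>Here \<open>A + B\<close> is the product of graphs and \<open>0\<close> is the empty graph.\<close>

definition \<V> :: "(nat \<Rightarrow> nat) \<Rightarrow> nat \<Rightarrow> plgraph set" where
  "\<V> l d = {unlabel (A + B) | A B. A \<in> \<B> l d \<and> B \<in> \<B> l d \<and> connected_graph (unlabel (A + B))} - {0}"

definition eval_graph :: "(plgraph \<Rightarrow> real) \<Rightarrow> plgraph \<Rightarrow> real" where
  "eval_graph v G = (\<Prod>C\<in>#components G. v C)"

definition eval_comb :: "(plgraph \<Rightarrow> real) \<Rightarrow> graph_comb \<Rightarrow> real" where
  "eval_comb v a = (\<Sum>G\<in>Poly_Mapping.keys a. Poly_Mapping.lookup a G * eval_graph v G)"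

text \<open>
  A vector with coordinates indexed by \<open>\<V> l d\<close> is an extensional function on \<open>\<V> l d\<close>.
\<close>

definition sos_profile :: "(nat \<Rightarrow> nat) \<Rightarrow> nat \<Rightarrow> (plgraph \<Rightarrow> real) set" where
  "sos_profile l d = {v \<in> \<V> l d \<rightarrow>\<^sub>E {0..}. \<forall>a. is_sos d a \<longrightarrow> eval_comb v a \<ge> 0}"

definition sos_testable :: "(nat \<Rightarrow> nat) \<Rightarrow> graph_comb \<Rightarrow> bool" where
  "sos_testable l a \<longleftrightarrow> unlabeled_comb a \<and> (\<exists>d.
     (\<forall>G\<in>Poly_Mapping.keys a. set_mset (components G) \<subseteq> \<V> l d) \<and>
     (\<forall>v\<in>sos_profile l d. eval_comb v a \<ge> 0))"

end

theory Submission
  imports Defs "HOL-Computational_Algebra.Polynomial"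
begin

text \<open>
  Let \<open>v\<close> lie in the \<open>d\<close>-sos-profile. If \<open>b(v) > 0\<close> then \<open>a(v) = c(v) / b(v) \<ge> 0\<close>, so \<open>v\<close> has to be
  approximated by points of the profile at which \<open>b\<close> does not vanish. Treating \<open>v\<close> like a graphon, let
  \<open>v\<^sub>s\<close> be the densities of the disjoint union of \<open>v\<close>, scaled to mass \<open>1 - s\<close>, and of a graph \<open>G\<close>, scaled
  to mass \<open>s\<close>. Mapping the labeled vertices at random and conditioning on their images shows that \<open>v\<^sub>s\<close>
  stays in the profile. Now \<open>a(v\<^sub>s)\<close> and \<open>b(v\<^sub>s)\<close> are polynomials in \<open>s\<close>, at \<open>s = 0\<close> we recover \<open>v\<close>, and at
  \<open>s = 1\<close> we get \<open>b(G)\<close>, which is nonzero for a suitable \<open>G\<close>. Hence \<open>b(v\<^sub>s) > 0\<close> for all small \<open>s > 0\<close>.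
\<close>

section \<open>Graphs and their representatives\<close>

text \<open>A point of the profile need not come from a graphon: about \<open>v\<close> only the
  signs of its coordinates and of squares are known. The constraints are polynomial in the
  coordinates, so the segment from \<open>v\<close> to the densities of a graph is no evident path
  inside the profile. The disjoint union is therefore formed formally: a vertex goes to
  \<open>None\<close> or into the graph, and the edges whose ends all go to \<open>None\<close> form
  a graph that is evaluated by \<open>v\<close>. Positivity survives because, once the images of the
  labeled vertices are fixed, the square of \<open>p\<close> becomes the value at \<open>v\<close>
  of another square. Its constituents come from a graph of \<open>p\<close> and a map of the
  unlabeled vertices, with only the edges in the graphon part kept. Deleting edges keeps the bound
  \<open>d\<close>, so \<open>v\<^sub>s\<close> stays at the level of \<open>v\<close>. The
  components that arise must be coordinates of \<open>v\<close>. This is why \<open>\<V> l d\<close>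
  is identified with the nonempty connected unlabeled graphs with at most \<open>2 * d\<close>
  edges, which also makes profiles of different levels comparable.\<close>

lemma plgraph_iso_refl_iff: "plgraph_iso E E \<longleftrightarrow> is_plgraph E"
  using plgraph_iso_refl by (auto simp: plgraph_iso_def)

lemma abs_rep_plgraph [simp]: "abs_plgraph (rep_plgraph G) = G"
  by (rule Quotient3_abs_rep[OF Quotient3_plgraph])

lemma is_plgraph_rep [simp]: "is_plgraph (rep_plgraph G)"
  using Quotient3_rep_reflp[OF Quotient3_plgraph] by (simp add: plgraph_iso_refl_iff)

lemma abs_plgraph_eqI: "plgraph_iso E F \<Longrightarrow> abs_plgraph E = abs_plgraph F"
  by (rule Quotient3_rel_abs[OF Quotient3_plgraph])

lemmas plgraph_abs_simps =
  plus_plgraph.abs_eq[unfolded plgraph_iso_refl_iff] unlabel.abs_eq[unfolded plgraph_iso_refl_iff]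
  components.abs_eq[unfolded plgraph_iso_refl_iff] num_edges.abs_eq[unfolded plgraph_iso_refl_iff]
  labels.abs_eq[unfolded plgraph_iso_refl_iff] connected_graph.abs_eq[unfolded plgraph_iso_refl_iff]

lemma is_plgraph_finite: "is_plgraph E \<Longrightarrow> finite E"
  by (simp add: is_plgraph_def)

lemma is_plgraph_nonempty: "is_plgraph E \<Longrightarrow> e \<in> E \<Longrightarrow> e \<noteq> {}"
  by (auto simp: is_plgraph_def)

lemma is_plgraph_finite_verts: "is_plgraph E \<Longrightarrow> finite (\<Union>E)"
  by (metis card.infinite finite_Union is_plgraph_def zero_neq_numeral)

lemma is_plgraph_subset: "is_plgraph E \<Longrightarrow> F \<subseteq> E \<Longrightarrow> is_plgraph F"
  by (auto simp: is_plgraph_def intro: finite_subset)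

lemma is_plgraph_drop_label: "is_plgraph E \<Longrightarrow> is_plgraph ((`) drop_label ` E)"
  by (rule is_plgraph_image) (auto simp: inj_on_def, metis drop_label_neq_Lab)

lemma plgraph_iso_drop_label:
  assumes "is_plgraph E" "inj_on f (\<Union>E)"
  shows "plgraph_iso ((`) drop_label ` E) ((`) drop_label ` (`) f ` E)"
proof (rule plgraph_isoI[where f = "drop_label \<circ> f \<circ> inv drop_label"])
  have d: "inj drop_label" by (simp add: inj_on_def)
  have U: "\<Union>((`) drop_label ` E) = drop_label ` \<Union>E" by blast
  show "is_plgraph ((`) drop_label ` E)" using assms(1) by (rule is_plgraph_drop_label)
  show "inj_on (drop_label \<circ> f \<circ> inv drop_label) (\<Union>((`) drop_label ` E))"
    unfolding U using assms(2) by (auto simp: inj_on_def d)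
  show "(drop_label \<circ> f \<circ> inv drop_label) x = Lab n \<longleftrightarrow> x = Lab n"
    if "x \<in> \<Union>((`) drop_label ` E)" for x n
    using that unfolding U by auto
  show "(`) drop_label ` (`) f ` E = (`) (drop_label \<circ> f \<circ> inv drop_label) ` (`) drop_label ` E"
    by (simp add: image_image d)
qed

text \<open>Once labels are forgotten only the isomorphism type of the bare graph is left, so
  \<open>f\<close> may create, destroy or move labels. The label 0 is excluded because
  \<open>is_plgraph\<close> forbids it.\<close>

lemma unlabel_abs_image:
  assumes "is_plgraph E" "inj_on f (\<Union>E)" "Lab 0 \<notin> f ` \<Union>E"
  shows "unlabel (abs_plgraph ((`) f ` E)) = unlabel (abs_plgraph E)"
  using assms abs_plgraph_eqI[OF plgraph_iso_drop_label[OF assms(1,2)]]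
  by (simp add: plgraph_abs_simps is_plgraph_image)

lemma labels_rep: "labels G = {n. Lab n \<in> \<Union>(rep_plgraph G)}"
  using plgraph_abs_simps(5)[OF is_plgraph_rep[of G]] by simp

lemma num_edges_rep: "num_edges G = card (rep_plgraph G)"
  using plgraph_abs_simps(4)[OF is_plgraph_rep[of G]] by simp

lemma unlabeled_unlabel [simp]: "unlabeled (unlabel G)"
proof -
  have "unlabel G = abs_plgraph ((`) drop_label ` rep_plgraph G)"
    using plgraph_abs_simps(2)[OF is_plgraph_rep[of G]] by simp
  then show ?thesis
    by (auto simp: unlabeled_def plgraph_abs_simps is_plgraph_drop_label)
       (metis drop_label_neq_Lab)
qed

lemma unlabel_unlabeled:
  assumes "unlabeled G"
  shows "unlabel G = G"
proof -
  let ?E = "rep_plgraph G"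
  have nl: "Lab n \<notin> \<Union>?E" for n using assms by (auto simp: unlabeled_def labels_rep)
  have "plgraph_iso ?E ((`) drop_label ` ?E)"
    by (rule plgraph_isoI[where f = drop_label]) (use nl in \<open>auto simp: inj_on_def\<close>)
  then show ?thesis
    using abs_plgraph_eqI plgraph_abs_simps(2)[OF is_plgraph_rep[of G]] by fastforce
qed

lemma unlabel_0 [simp]: "unlabel 0 = 0"
proof -
  have "is_plgraph {}" by (simp add: is_plgraph_def)
  from plgraph_abs_simps(2)[OF this] show ?thesis unfolding zero_plgraph_def by simp
qed

lemma num_edges_unlabel: "num_edges (unlabel G) = num_edges G"
proof -
  have "inj ((`) drop_label)"
    by (rule inj_onI) (metis drop_label_eq_iff injI inj_image_eq_iff)
  then have "card ((`) drop_label ` rep_plgraph G) = card (rep_plgraph G)"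
    by (meson card_image inj_on_subset subset_UNIV)
  then show ?thesis
    using plgraph_abs_simps(2)[OF is_plgraph_rep[of G]]
    by (simp add: num_edges_rep plgraph_abs_simps is_plgraph_drop_label)
       (metis is_plgraph_drop_label is_plgraph_rep num_edges_rep plgraph_abs_simps(4))
qed

lemma num_edges_add: "num_edges (G + H) \<le> num_edges G + num_edges H"
proof -
  let ?E = "rep_plgraph G" and ?F = "rep_plgraph H"
  have "G + H = abs_plgraph (glue ?E ?F)"
    using plgraph_abs_simps(1)[OF is_plgraph_rep[of G] is_plgraph_rep[of H]] by simp
  then have "num_edges (G + H) = card (glue ?E ?F)"
    by (simp add: plgraph_abs_simps is_plgraph_glue)
  also have "\<dots> \<le> card ((`) shiftL ` ?E) + card ((`) shiftR ` ?F)"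
    unfolding glue_def by (rule card_Un_le)
  also have "\<dots> \<le> card ?E + card ?F"
    by (intro add_mono card_image_le is_plgraph_finite is_plgraph_rep)
  finally show ?thesis by (simp add: num_edges_rep)
qed

section \<open>Components\<close>

lemma adj_sym: "(x, y) \<in> adj E \<Longrightarrow> (y, x) \<in> adj E"
  by (simp add: adj_def insert_commute)

lemma adj_rtrancl_sym: "(x, y) \<in> (adj E)\<^sup>* \<Longrightarrow> (y, x) \<in> (adj E)\<^sup>*"
  by (meson adj_sym symE symI sym_rtrancl)

lemma edge_components_altdef:
  "edge_components E = (\<lambda>u. {e \<in> E. e \<subseteq> (adj E)\<^sup>* `` {u}}) ` \<Union>E"
  by (auto simp: edge_components_def quotient_def)

lemma edge_subset_class:
  assumes "is_plgraph E" "e \<in> E" "x \<in> e" "(u, x) \<in> (adj E)\<^sup>*"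
  shows "e \<subseteq> (adj E)\<^sup>* `` {u}"
proof
  fix y assume "y \<in> e"
  have "card e = 2" using assms by (auto simp: is_plgraph_def)
  then have "x = y \<or> e = {x, y}" using \<open>x \<in> e\<close> \<open>y \<in> e\<close>
    by (auto simp: card_2_iff)
  then have "(x, y) \<in> (adj E)\<^sup>*" using \<open>e \<in> E\<close> by (auto simp: adj_def)
  then show "y \<in> (adj E)\<^sup>* `` {u}" using assms(4) by (auto intro: rtrancl_trans)
qed

lemma edge_component_edges:
  assumes "is_plgraph E"
  shows "{e \<in> E. e \<subseteq> (adj E)\<^sup>* `` {u}} = {e \<in> E. e \<inter> (adj E)\<^sup>* `` {u} \<noteq> {}}"
proof -
  have "e \<subseteq> (adj E)\<^sup>* `` {u} \<longleftrightarrow> e \<inter> (adj E)\<^sup>* `` {u} \<noteq> {}" if "e \<in> E" for e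
    using edge_subset_class[OF assms that] is_plgraph_nonempty[OF assms that] by blast
  then show ?thesis by blast
qed

lemma edge_component_verts:
  assumes "is_plgraph E" "u \<in> \<Union>E"
  shows "\<Union>{e \<in> E. e \<subseteq> (adj E)\<^sup>* `` {u}} = (adj E)\<^sup>* `` {u}"
proof
  show "(adj E)\<^sup>* `` {u} \<subseteq> \<Union>{e \<in> E. e \<subseteq> (adj E)\<^sup>* `` {u}}"
    unfolding edge_component_edges[OF assms(1)]
  proof
    fix x assume x: "x \<in> (adj E)\<^sup>* `` {u}"
    then have "x \<in> \<Union>E" using assms(2) by (auto dest: adj_rtrancl_closed)
    then show "x \<in> \<Union>{e \<in> E. e \<inter> (adj E)\<^sup>* `` {u} \<noteq> {}}" using x by blast
  qed
qed auto

lemma edge_component_subset: "C \<in> edge_components E \<Longrightarrow> C \<subseteq> E"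
  by (auto simp: edge_components_def)

lemma edge_component_nonempty:
  assumes "is_plgraph E" "C \<in> edge_components E"
  shows "C \<noteq> {}"
proof -
  obtain u where u: "u \<in> \<Union>E" "C = {e \<in> E. e \<subseteq> (adj E)\<^sup>* `` {u}}"
    using assms(2) by (auto simp: edge_components_altdef)
  have "u \<in> \<Union>C" unfolding u(2) edge_component_verts[OF assms(1) u(1)] by simp
  then show ?thesis by blast
qed

lemma finite_edge_components: "is_plgraph E \<Longrightarrow> finite (edge_components E)"
  by (rule finite_subset[of _ "Pow E"]) (auto dest: edge_component_subset is_plgraph_finite)

lemma Union_edge_components:
  assumes "is_plgraph E"
  shows "\<Union>(edge_components E) = E"
proof
  show "E \<subseteq> \<Union>(edge_components E)"
  proof
    fix e assume e: "e \<in> E"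
    then obtain u where "u \<in> e" using is_plgraph_nonempty[OF assms] by blast
    then show "e \<in> \<Union>(edge_components E)"
      using e edge_subset_class[OF assms e, of u u] unfolding edge_components_altdef by auto
  qed
qed (auto dest: edge_component_subset)

lemma edge_components_disjoint:
  assumes "is_plgraph E" "C \<in> edge_components E" "C' \<in> edge_components E" "C \<noteq> C'"
  shows "\<Union>C \<inter> \<Union>C' = {}"
proof (rule ccontr)
  assume "\<Union>C \<inter> \<Union>C' \<noteq> {}"
  then obtain x where x: "x \<in> \<Union>C" "x \<in> \<Union>C'" by blast
  obtain u where u: "u \<in> \<Union>E" "C = {e \<in> E. e \<subseteq> (adj E)\<^sup>* `` {u}}"
    using assms(2) by (auto simp: edge_components_altdef)
  obtain u' where u': "u' \<in> \<Union>E" "C' = {e \<in> E. e \<subseteq> (adj E)\<^sup>* `` {u'}}"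
    using assms(3) by (auto simp: edge_components_altdef)
  have "(u, x) \<in> (adj E)\<^sup>*" "(u', x) \<in> (adj E)\<^sup>*"
    using x u u' by auto
  then have "(u, u') \<in> (adj E)\<^sup>*" "(u', u) \<in> (adj E)\<^sup>*"
    by (meson adj_rtrancl_sym rtrancl_trans)+
  then have "(adj E)\<^sup>* `` {u} = (adj E)\<^sup>* `` {u'}"
    by (auto intro: rtrancl_trans)
  then show False using u u' assms(4) by simp
qed

lemma connected_edge_component:
  assumes "is_plgraph E" "C \<in> edge_components E"
  shows "connected_graph (abs_plgraph C)"
proof -
  obtain u where u: "u \<in> \<Union>E" "C = {e \<in> E. e \<subseteq> (adj E)\<^sup>* `` {u}}"
    using assms(2) by (auto simp: edge_components_altdef)
  \<comment> \<open>A walk from \<open>u\<close> never leaves the class of \<open>u\<close>, so each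
    of its edges belongs to \<open>C\<close>.\<close>
  have r: "(u, x) \<in> (adj C)\<^sup>*" if "(u, x) \<in> (adj E)\<^sup>*" for x
    using that
  proof (induction rule: rtrancl_induct)
    case (step y z)
    then have "{y, z} \<in> E" by (simp add: adj_def)
    moreover have "{y, z} \<subseteq> (adj E)\<^sup>* `` {u}" using step by (auto intro: rtrancl_into_rtrancl)
    ultimately have "(y, z) \<in> adj C" unfolding u by (simp add: adj_def)
    with step.IH show ?case by (rule rtrancl_into_rtrancl)
  qed simp
  have V: "\<Union>C = (adj E)\<^sup>* `` {u}" unfolding u(2) by (rule edge_component_verts[OF assms(1) u(1)])
  have C: "is_plgraph C" using assms edge_component_subset is_plgraph_subset by blast
  have "(x, y) \<in> (adj C)\<^sup>*" if "x \<in> \<Union>C" "y \<in> \<Union>C" for x y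
    using that r unfolding V by (auto intro: rtrancl_trans adj_rtrancl_sym)
  then show ?thesis using C by (simp add: plgraph_abs_simps)
qed

lemma adj_rtrancl_Un:
  assumes "\<Union>E \<inter> \<Union>F = {}" "u \<in> \<Union>E"
  shows "(adj (E \<union> F))\<^sup>* `` {u} = (adj E)\<^sup>* `` {u}"
proof -
  have "(u, x) \<in> (adj E)\<^sup>*" if "(u, x) \<in> (adj (E \<union> F))\<^sup>*" for x
    using that
  proof (induction rule: rtrancl_induct)
    case (step y z)
    then have "y \<in> \<Union>E" using adj_rtrancl_closed assms(2) by blast
    then have "(y, z) \<in> adj E" using step.hyps assms(1) by (auto simp: adj_def)
    with step.IH show ?case by (rule rtrancl_into_rtrancl)
  qed simp
  moreover have "(adj E)\<^sup>* \<subseteq> (adj (E \<union> F))\<^sup>*" by (rule rtrancl_mono) (auto simp: adj_def)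
  ultimately show ?thesis by blast
qed

lemma edge_components_Un:
  assumes E: "is_plgraph E" and F: "is_plgraph F" and dis: "\<Union>E \<inter> \<Union>F = {}"
  shows "edge_components (E \<union> F) = edge_components E \<union> edge_components F"
proof -
  have *: "{e \<in> E \<union> F. e \<subseteq> (adj (E \<union> F))\<^sup>* `` {u}} = {e \<in> E. e \<subseteq> (adj E)\<^sup>* `` {u}}"
    if "is_plgraph F" "\<Union>E \<inter> \<Union>F = {}" "u \<in> \<Union>E" for E F u
  proof -
    have "(adj E)\<^sup>* `` {u} \<subseteq> \<Union>E" using that adj_rtrancl_closed by blast
    then have "\<not> e \<subseteq> (adj E)\<^sup>* `` {u}" if "e \<in> F" for e
      using \<open>\<Union>E \<inter> \<Union>F = {}\<close> is_plgraph_nonempty[OF \<open>is_plgraph F\<close> that] that by blast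
    then show ?thesis using adj_rtrancl_Un[OF that(2,3)] by auto
  qed
  have "edge_components (E \<union> F) = (\<lambda>u. {e \<in> E \<union> F. e \<subseteq> (adj (E \<union> F))\<^sup>* `` {u}}) ` \<Union>E
      \<union> (\<lambda>u. {e \<in> E \<union> F. e \<subseteq> (adj (E \<union> F))\<^sup>* `` {u}}) ` \<Union>F"
    unfolding edge_components_altdef by blast
  also have "(\<lambda>u. {e \<in> E \<union> F. e \<subseteq> (adj (E \<union> F))\<^sup>* `` {u}}) ` \<Union>E = edge_components E"
    unfolding edge_components_altdef by (rule image_cong[OF refl]) (rule *[OF F dis])
  also have "(\<lambda>u. {e \<in> E \<union> F. e \<subseteq> (adj (E \<union> F))\<^sup>* `` {u}}) ` \<Union>F = edge_components F"
    unfolding edge_components_altdef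
    by (rule image_cong[OF refl]) (use *[OF E, of F] dis in \<open>simp only: Un_commute[of E F] Int_commute[of "\<Union>E"]\<close>)
  finally show ?thesis .
qed

lemma eval_graph_abs:
  assumes "is_plgraph E"
  shows "eval_graph v (abs_plgraph E) = (\<Prod>C\<in>edge_components E. v (abs_plgraph C))"
  using assms
  by (simp add: eval_graph_def plgraph_abs_simps image_mset.compositionality o_def prod_unfold_prod_mset)

lemma eval_graph_Un:
  assumes "is_plgraph E" "is_plgraph F" "\<Union>E \<inter> \<Union>F = {}"
  shows "eval_graph v (abs_plgraph (E \<union> F)) = eval_graph v (abs_plgraph E) * eval_graph v (abs_plgraph F)"
proof -
  have "edge_components E \<inter> edge_components F = {}"
  proof (rule ccontr)
    assume "edge_components E \<inter> edge_components F \<noteq> {}"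
    then obtain C where C: "C \<in> edge_components E" "C \<in> edge_components F" by blast
    then obtain e where "e \<in> C" using edge_component_nonempty[OF assms(1)] by blast
    then have "e \<in> E" "e \<in> F" using C edge_component_subset by blast+
    then show False using assms is_plgraph_nonempty by blast
  qed
  then show ?thesis
    using assms
    by (simp add: eval_graph_abs is_plgraph_Un edge_components_Un prod.union_disjoint finite_edge_components)
qed

lemma eval_graph_0: "eval_graph v 0 = 1"
proof -
  have "edge_components {} = {}" by (simp add: edge_components_altdef)
  then show ?thesis
    using eval_graph_abs[of "{}" v] by (simp add: zero_plgraph_def is_plgraph_def)
qed

text \<open>Without labels nothing is glued: the product is a disjoint union, and its components are
  those of both factors.\<close>

lemma eval_graph_add:
  assumes "unlabeled G" "unlabeled H"
  shows "eval_graph v (G + H) = eval_graph v G * eval_graph v H"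
proof -
  let ?E = "rep_plgraph G" and ?F = "rep_plgraph H"
  let ?L = "(`) shiftL ` ?E" and ?R = "(`) shiftR ` ?F"
  have nl: "Lab n \<notin> \<Union>?E" "Lab n \<notin> \<Union>?F" for n
    using assms by (auto simp: unlabeled_def labels_rep)
  have L: "plgraph_iso ?E ?L" by (rule plgraph_isoI[where f = shiftL]) (auto simp: inj_on_def)
  have R: "plgraph_iso ?F ?R" by (rule plgraph_isoI[where f = shiftR]) (auto simp: inj_on_def)
  have "\<Union>?L \<inter> \<Union>?R = {}" using nl by (auto simp: shiftL_eq_shiftR_iff)
  moreover have "is_plgraph ?L" "is_plgraph ?R" using L R by (auto simp: plgraph_iso_def)
  ultimately have "eval_graph v (abs_plgraph (glue ?E ?F))
      = eval_graph v (abs_plgraph ?L) * eval_graph v (abs_plgraph ?R)"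
    unfolding glue_def by (intro eval_graph_Un)
  moreover have "abs_plgraph ?L = G" "abs_plgraph ?R = H"
    using abs_plgraph_eqI[OF L] abs_plgraph_eqI[OF R] by simp_all
  ultimately show ?thesis
    using plgraph_abs_simps(1)[OF is_plgraph_rep[of G] is_plgraph_rep[of H]] by simp
qed

text \<open>Induction over subfamilies of the components, which have disjoint vertex sets. Applied
  to \<open>blend\<close>, it shows that the values on connected graphs determine all
  others.\<close>

lemma prod_edge_components:
  fixes g :: "vert set set \<Rightarrow> real"
  assumes "is_plgraph E" "g {} = 1"
    and mult: "\<And>E F. is_plgraph E \<Longrightarrow> is_plgraph F \<Longrightarrow> \<Union>E \<inter> \<Union>F = {} \<Longrightarrow> g (E \<union> F) = g E * g F"
  shows "g E = (\<Prod>C\<in>edge_components E. g C)"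
proof -
  have "g (\<Union>\<C>) = (\<Prod>C\<in>\<C>. g C)" if "finite \<C>" "\<C> \<subseteq> edge_components E" for \<C>
    using that
  proof (induction rule: finite_induct)
    case (insert C \<C>)
    have "\<Union>\<C> \<subseteq> E" "C \<subseteq> E" using insert.prems by (auto dest!: edge_component_subset)
    then have "is_plgraph (\<Union>\<C>)" "is_plgraph C" using assms(1) is_plgraph_subset by blast+
    moreover have "\<Union>C \<inter> \<Union>(\<Union>\<C>) = {}"
    proof -
      have "\<Union>C \<inter> \<Union>C' = {}" if "C' \<in> \<C>" for C'
        using that insert edge_components_disjoint[OF assms(1), of C C'] by blast
      then show ?thesis by blast
    qed
    ultimately show ?case using insert mult[of C "\<Union>\<C>"] by simp
  qed (simp add: assms)
  from this[OF finite_edge_components] show ?thesis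
    using assms(1) Union_edge_components by simp
qed

section \<open>Graph combinations\<close>

lemma sum_single_keys: "(\<Sum>G\<in>Poly_Mapping.keys a. Poly_Mapping.single G (Poly_Mapping.lookup a G)) = a"
  by (rule poly_mapping_eqI)
    (auto simp: lookup_sum lookup_single when_def in_keys_iff sum.delta' if_distrib cong: if_cong)

lemma eval_comb_superset:
  assumes "finite S" "Poly_Mapping.keys a \<subseteq> S"
  shows "eval_comb v a = (\<Sum>G\<in>S. Poly_Mapping.lookup a G * eval_graph v G)"
  unfolding eval_comb_def using assms
  by (intro sum.mono_neutral_left) (auto simp: in_keys_iff)

lemma eval_comb_0 [simp]: "eval_comb v 0 = 0"
  by (simp add: eval_comb_def)

lemma eval_comb_add: "eval_comb v (a + b) = eval_comb v a + eval_comb v b"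
proof -
  let ?S = "Poly_Mapping.keys a \<union> Poly_Mapping.keys b"
  show ?thesis
    using eval_comb_superset[of ?S "a + b" v] eval_comb_superset[of ?S a v]
      eval_comb_superset[of ?S b v] keys_add[of a b]
    by (simp add: lookup_add algebra_simps sum.distrib)
qed

lemma eval_comb_sum: "eval_comb v (\<Sum>i\<in>I. f i) = (\<Sum>i\<in>I. eval_comb v (f i))"
  by (induction I rule: infinite_finite_induct) (auto simp: eval_comb_add)

lemma eval_comb_sum_list: "eval_comb v (\<Sum>i\<leftarrow>is. f i) = (\<Sum>i\<leftarrow>is. eval_comb v (f i))"
  by (induction "is") (auto simp: eval_comb_add)

lemma eval_comb_single [simp]: "eval_comb v (Poly_Mapping.single G c) = c * eval_graph v G"
  by (simp add: eval_comb_def)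

lemma unlabel_comb_superset:
  assumes "finite S" "Poly_Mapping.keys a \<subseteq> S"
  shows "unlabel_comb a = (\<Sum>G\<in>S. Poly_Mapping.single (unlabel G) (Poly_Mapping.lookup a G))"
  unfolding unlabel_comb_def using assms
  by (intro sum.mono_neutral_left) (auto simp: in_keys_iff)

lemma unlabel_comb_add: "unlabel_comb (a + b) = unlabel_comb a + unlabel_comb b"
proof -
  let ?S = "Poly_Mapping.keys a \<union> Poly_Mapping.keys b"
  show ?thesis
    using unlabel_comb_superset[of ?S "a + b"] unlabel_comb_superset[of ?S a]
      unlabel_comb_superset[of ?S b] keys_add[of a b]
    by (simp add: lookup_add single_add sum.distrib)
qed

lemma unlabel_comb_sum: "unlabel_comb (\<Sum>i\<in>I. f i) = (\<Sum>i\<in>I. unlabel_comb (f i))"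
  by (induction I rule: infinite_finite_induct) (auto simp: unlabel_comb_add, auto simp: unlabel_comb_def)

lemma unlabel_comb_single: "unlabel_comb (Poly_Mapping.single G c) = Poly_Mapping.single (unlabel G) c"
  by (simp add: unlabel_comb_def)

lemma eval_comb_mult:
  assumes "unlabeled_comb a" "unlabeled_comb b"
  shows "eval_comb v (a * b) = eval_comb v a * eval_comb v b"
proof -
  have "eval_comb v (a * b) = eval_comb v
    ((\<Sum>G\<in>Poly_Mapping.keys a. Poly_Mapping.single G (Poly_Mapping.lookup a G)) *
     (\<Sum>H\<in>Poly_Mapping.keys b. Poly_Mapping.single H (Poly_Mapping.lookup b H)))"
    by (simp only: sum_single_keys)
  also have "\<dots> = (\<Sum>G\<in>Poly_Mapping.keys a. \<Sum>H\<in>Poly_Mapping.keys b.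
      Poly_Mapping.lookup a G * Poly_Mapping.lookup b H * eval_graph v (G + H))"
    by (simp add: sum_product eval_comb_sum mult_single)
  also have "\<dots> = (\<Sum>G\<in>Poly_Mapping.keys a. \<Sum>H\<in>Poly_Mapping.keys b.
      (Poly_Mapping.lookup a G * eval_graph v G) * (Poly_Mapping.lookup b H * eval_graph v H))"
    using assms by (intro sum.cong refl) (auto simp: unlabeled_comb_def eval_graph_add)
  also have "\<dots> = eval_comb v a * eval_comb v b"
    by (simp add: eval_comb_def sum_product)
  finally show ?thesis .
qed

text \<open>The graphs \<open>g i\<close> may repeat. This matters in \<open>blend_positive\<close>,
  where different maps can leave the same graph.\<close>

lemma eval_comb_unlabel_square:
  "eval_comb v (unlabel_comb ((\<Sum>i\<in>I. Poly_Mapping.single (g i) (c i))\<^sup>2))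
    = (\<Sum>i\<in>I. \<Sum>j\<in>I. c i * c j * eval_graph v (unlabel (g i + g j)))"
  by (simp add: power2_eq_square sum_product mult_single unlabel_comb_sum eval_comb_sum
      unlabel_comb_single)

text \<open>Only an inclusion, because coefficients of graphs that become equal can cancel.\<close>

lemma keys_unlabel_comb: "Poly_Mapping.keys (unlabel_comb a) \<subseteq> unlabel ` Poly_Mapping.keys a"
proof
  fix H assume "H \<in> Poly_Mapping.keys (unlabel_comb a)"
  then have "(\<Sum>G\<in>Poly_Mapping.keys a. Poly_Mapping.lookup a G when unlabel G = H) \<noteq> 0"
    by (simp add: in_keys_iff unlabel_comb_def lookup_sum lookup_single)
  then obtain G where "G \<in> Poly_Mapping.keys a" "(Poly_Mapping.lookup a G when unlabel G = H) \<noteq> 0"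
    by (meson sum.not_neutral_contains_not_neutral)
  then show "H \<in> unlabel ` Poly_Mapping.keys a" by (auto simp: when_def split: if_splits)
qed

lemma keys_unlabel_square:
  assumes "H \<in> Poly_Mapping.keys (unlabel_comb (a\<^sup>2))"
  obtains A B where "A \<in> Poly_Mapping.keys a" "B \<in> Poly_Mapping.keys a" "H = unlabel (A + B)"
proof -
  obtain G where G: "G \<in> Poly_Mapping.keys (a * a)" "H = unlabel G"
    using assms keys_unlabel_comb[of "a\<^sup>2"] by (auto simp: power2_eq_square)
  then show ?thesis using keys_mult[of a a] that by blast
qed

lemma keys_sum_list:
  assumes "H \<in> Poly_Mapping.keys (\<Sum>i\<leftarrow>is. f i)"
  obtains i where "i \<in> set is" "H \<in> Poly_Mapping.keys (f i)"
  using assms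
proof (induction "is" arbitrary: thesis)
  case (Cons i "is")
  then consider "H \<in> Poly_Mapping.keys (f i)" | "H \<in> Poly_Mapping.keys (\<Sum>i\<leftarrow>is. f i)"
    using keys_add[of "f i" "\<Sum>i\<leftarrow>is. f i"] by auto
  then show ?case using Cons by cases auto
qed simp

section \<open>The index set of the profile\<close>

lemma obtain_halves:
  assumes "finite E" "card E \<le> 2 * d"
  obtains E1 E2 where "E = E1 \<union> E2" "card E1 \<le> d" "card E2 \<le> d"
proof -
  obtain E1 where E1: "E1 \<subseteq> E" "card E1 = min d (card E)"
    by (metis min.cobounded2 obtain_subset_with_card_n)
  have "card (E - E1) = card E - card E1"
    using E1 assms by (simp add: card_Diff_subset finite_subset)
  then show ?thesis using that[of E1 "E - E1"] E1 assms by (simp add: Un_absorb1)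
qed

text \<open>
  If the edges of a connected graph are split into \<open>A\<close> and \<open>B\<close>, it occurs in the \<open>d\<close>-sos
  combination \<open>[[(A + B)\<^sup>2]]\<close>, hence in every way of writing that combination with few labels.
\<close>

lemma \<V>_eq:
  assumes "label_bound l"
  shows "\<V> l d = {C. unlabeled C \<and> connected_graph C \<and> num_edges C \<le> 2 * d \<and> C \<noteq> 0}"
proof (intro equalityI subsetI)
  fix C assume "C \<in> \<V> l d"
  then obtain A B where C: "C \<noteq> 0" "C = unlabel (A + B)" "A \<in> \<B> l d" "B \<in> \<B> l d" "connected_graph C"
    by (auto simp: \<V>_def)
  moreover have "num_edges C \<le> 2 * d"
    using num_edges_add[of A B] C by (simp add: num_edges_unlabel \<B>_def)
  ultimately show "C \<in> {C. unlabeled C \<and> connected_graph C \<and> num_edges C \<le> 2 * d \<and> C \<noteq> 0}"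
    by simp
next
  fix C assume "C \<in> {C. unlabeled C \<and> connected_graph C \<and> num_edges C \<le> 2 * d \<and> C \<noteq> 0}"
  then have C: "unlabeled C" "connected_graph C" "num_edges C \<le> 2 * d" "C \<noteq> 0" by auto
  let ?E = "rep_plgraph C"
  obtain E1 E2 where E: "?E = E1 \<union> E2" "card E1 \<le> d" "card E2 \<le> d"
    using obtain_halves[of ?E d] C(3) by (auto simp: num_edges_rep is_plgraph_finite)
  \<comment> \<open>Every vertex gets a label of its own, so gluing the images of \<open>E1\<close>
    and \<open>E2\<close> yields their union. The labels are odd, or even from 2 on, which avoids
    the forbidden 0.\<close>
  define f where "f x = (case x of Lab n \<Rightarrow> Lab (2 * n + 2) | Unl n \<Rightarrow> Lab (2 * n + 1))" for x
  have f: "inj f" by (rule injI) (auto simp: f_def split: vert.splits, presburger+)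
  have f0: "f x \<noteq> Lab 0" for x by (simp add: f_def split: vert.splits)
  have sf: "shiftL (f x) = f x" "shiftR (f x) = f x" for x by (simp_all add: f_def split: vert.splits)
  have g: "is_plgraph E1" "is_plgraph E2" using E(1) is_plgraph_rep[of C]
    by (metis Un_upper1 Un_upper2 is_plgraph_subset)+
  have gf: "is_plgraph ((`) f ` E')" if "is_plgraph E'" for E'
    by (rule is_plgraph_image[OF that]) (use f f0 in \<open>auto intro: inj_on_subset simp: image_iff, metis\<close>)
  define A where "A = abs_plgraph ((`) f ` E1)"
  define B where "B = abs_plgraph ((`) f ` E2)"
  have "A + B = abs_plgraph (glue ((`) f ` E1) ((`) f ` E2))"
    unfolding A_def B_def by (simp add: plgraph_abs_simps gf g)
  also have "glue ((`) f ` E1) ((`) f ` E2) = (`) f ` ?E"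
    by (simp add: glue_def image_image sf E(1) image_Un)
  finally have "unlabel (A + B) = unlabel (abs_plgraph ?E)"
    using unlabel_abs_image[OF is_plgraph_rep inj_on_subset[OF f subset_UNIV], of C] f0
    by (simp add: image_iff not_sym)
  then have AB: "unlabel (A + B) = C" using C(1) by (simp add: unlabel_unlabeled)
  have cf: "card ((`) f ` E') \<le> d" if "card E' \<le> d" "is_plgraph E'" for E'
    using card_image_le[OF is_plgraph_finite[OF that(2)]] that(1) by (rule order.trans)
  have AB_edges: "num_edges A \<le> d" "num_edges B \<le> d"
    unfolding A_def B_def using cf E g by (simp_all add: plgraph_abs_simps gf)
  define a :: graph_comb where "a = Poly_Mapping.single A 1 + Poly_Mapping.single B 1"
  have ka: "Poly_Mapping.keys a \<subseteq> {A, B}" unfolding a_def using keys_add by fastforce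
  have "unlabel_comb (a\<^sup>2) = Poly_Mapping.single (unlabel (A + A)) 1
      + Poly_Mapping.single C 1 + (Poly_Mapping.single C 1 + Poly_Mapping.single (unlabel (B + B)) 1)"
    by (simp only: a_def power2_eq_square distrib_left distrib_right mult_single unlabel_comb_add
        unlabel_comb_single AB add.commute[of B A] mult_1)
  \<comment> \<open>Both mixed products contribute 1 to the coefficient of \<open>C\<close> and the
    other two terms are nonnegative, so nothing cancels.\<close>
  then have "Poly_Mapping.lookup (unlabel_comb (a\<^sup>2)) C > 0"
    by (simp only: lookup_add lookup_single) (simp add: when_def)
  then have key: "C \<in> Poly_Mapping.keys (unlabel_comb (a\<^sup>2))" by (simp add: in_keys_iff)
  have "is_sos d (unlabel_comb (a\<^sup>2))"
    unfolding is_sos_def by (rule exI[of _ "[a]"]) (use ka AB_edges in auto)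
  \<comment> \<open>Rewriting with few labels may change all squares, but one of them must still
    contain \<open>C\<close>, which is then glued from two graphs with labels up to
    \<open>l d\<close>.\<close>
  then have "is_sos_labels (l d) d (unlabel_comb (a\<^sup>2))"
    using assms by (simp add: label_bound_def)
  then obtain as where as: "\<And>a G. a \<in> set as \<Longrightarrow> G \<in> Poly_Mapping.keys a \<Longrightarrow> num_edges G \<le> d \<and> labels G \<subseteq> {1..l d}"
    "unlabel_comb (a\<^sup>2) = (\<Sum>a\<leftarrow>as. unlabel_comb (a\<^sup>2))"
    unfolding is_sos_labels_def by blast
  obtain a' where a': "a' \<in> set as" "C \<in> Poly_Mapping.keys (unlabel_comb (a'\<^sup>2))"
    using key unfolding as(2) by (rule keys_sum_list)
  then obtain A' B' where "A' \<in> Poly_Mapping.keys a'" "B' \<in> Poly_Mapping.keys a'" "C = unlabel (A' + B')"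
    using keys_unlabel_square by blast
  then have "A' \<in> \<B> l d" "B' \<in> \<B> l d" "C = unlabel (A' + B')"
    using as(1) a'(1) by (auto simp: \<B>_def)
  then show "C \<in> \<V> l d" using C unfolding \<V>_def by blast
qed

lemma \<V>_mono: "label_bound l \<Longrightarrow> d \<le> d' \<Longrightarrow> \<V> l d \<subseteq> \<V> l d'"
  using \<V>_eq[of l d] \<V>_eq[of l d'] by fastforce

text \<open>Ensures that a square of graphs with at most \<open>d\<close> edges is a polynomial in
  the coordinates of the profile.\<close>

lemma components_subset_\<V>:
  assumes "label_bound l" "unlabeled G" "num_edges G \<le> 2 * d"
  shows "set_mset (components G) \<subseteq> \<V> l d"
proof
  fix H assume "H \<in> set_mset (components G)"
  moreover have "components G = image_mset abs_plgraph (mset_set (edge_components (rep_plgraph G)))"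
    using plgraph_abs_simps(3)[OF is_plgraph_rep[of G]] by simp
  ultimately obtain C where C: "C \<in> edge_components (rep_plgraph G)" "H = abs_plgraph C"
    by (auto simp: finite_edge_components)
  have sub: "C \<subseteq> rep_plgraph G" using C edge_component_subset by blast
  then have gC: "is_plgraph C" using is_plgraph_rep is_plgraph_subset by blast
  have ne: "card C > 0" using edge_component_nonempty[OF _ C(1)] gC by (simp add: is_plgraph_finite card_gt_0_iff)
  have "num_edges H = card C" using C gC by (simp add: plgraph_abs_simps)
  moreover have "card C \<le> 2 * d"
    using card_mono[OF _ sub] assms(3) by (simp add: num_edges_rep is_plgraph_finite)
  \<comment> \<open>This rules out \<open>H = 0\<close>, since a component has at least one
    edge.\<close>
  moreover have "num_edges 0 = 0"
    unfolding zero_plgraph_def using plgraph_abs_simps(4)[of "{}"] by (simp add: is_plgraph_def)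
  moreover have "unlabeled H"
    using assms(2) sub C gC by (auto simp: unlabeled_def labels_rep[of G] plgraph_abs_simps)
  moreover have "connected_graph H" using connected_edge_component[OF _ C(1)] C by simp
  ultimately have "unlabeled H" "connected_graph H" "num_edges H \<le> 2 * d" "H \<noteq> 0"
    using ne by fastforce+
  then show "H \<in> \<V> l d" unfolding \<V>_eq[OF assms(1)] by blast
qed

section \<open>Random maps\<close>

text \<open>For finite \<open>S\<close> and \<open>U\<close> and nonnegative weights of sum 1, this
  is the expectation of \<open>g\<close> under a map that sends the points of \<open>S\<close> to
  \<open>U\<close> independently. Extensional maps keep the sample space finite.\<close>

definition expec :: "('u \<Rightarrow> real) \<Rightarrow> 'u set \<Rightarrow> 'a set \<Rightarrow> (('a \<Rightarrow> 'u) \<Rightarrow> real) \<Rightarrow> real" where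
  "expec w U S g = (\<Sum>\<phi>\<in>S \<rightarrow>\<^sub>E U. (\<Prod>x\<in>S. w (\<phi> x)) * g \<phi>)"

lemma expec_cong:
  "(\<And>\<phi>. \<phi> \<in> S \<rightarrow>\<^sub>E U \<Longrightarrow> g \<phi> = h \<phi>) \<Longrightarrow> expec w U S g = expec w U S h"
  unfolding expec_def by (intro sum.cong) auto

lemma expec_cmult: "expec w U S (\<lambda>\<phi>. c * g \<phi>) = c * expec w U S g"
  by (simp add: expec_def sum_distrib_left mult_ac)

lemma expec_multc: "expec w U S (\<lambda>\<phi>. g \<phi> * c) = expec w U S g * c"
  unfolding expec_def sum_distrib_right by (simp only: mult.assoc)

lemma expec_const:
  assumes "finite S" "finite U" "sum w U = 1"
  shows "expec w U S (\<lambda>_. c) = c"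
proof -
  have "(\<Sum>\<phi>\<in>S \<rightarrow>\<^sub>E U. \<Prod>x\<in>S. w (\<phi> x)) = 1"
    using prod_sum_PiE[of S "\<lambda>_. U" "\<lambda>_. w"] assms by simp
  then show ?thesis by (simp add: expec_def sum_distrib_right[symmetric])
qed

lemma expec_nonneg:
  assumes "\<And>u. u \<in> U \<Longrightarrow> w u \<ge> 0" "\<And>\<phi>. \<phi> \<in> S \<rightarrow>\<^sub>E U \<Longrightarrow> g \<phi> \<ge> 0"
  shows "expec w U S g \<ge> 0"
  unfolding expec_def by (intro sum_nonneg mult_nonneg_nonneg prod_nonneg) (use assms in auto)

text \<open>Fubini: the images of \<open>S\<close> and of \<open>T\<close> are independent.\<close>

lemma expec_Un:
  assumes "finite S" "finite T" "S \<inter> T = {}"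
  shows "expec w U (S \<union> T) g
    = expec w U S (\<lambda>\<phi>. expec w U T (\<lambda>\<psi>. g (\<lambda>x. if x \<in> S then \<phi> x else \<psi> x)))"
proof -
  let ?m = "\<lambda>(\<phi>, \<psi>) x. if x \<in> S then \<phi> x else \<psi> x"
  have bij: "bij_betw ?m ((S \<rightarrow>\<^sub>E U) \<times> (T \<rightarrow>\<^sub>E U)) (S \<union> T \<rightarrow>\<^sub>E U)"
  proof (rule bij_betwI)
    show "?m \<in> (S \<rightarrow>\<^sub>E U) \<times> (T \<rightarrow>\<^sub>E U) \<rightarrow> (S \<union> T \<rightarrow>\<^sub>E U)"
      by (auto simp: PiE_iff extensional_def)
    show "(\<lambda>\<chi>. (restrict \<chi> S, restrict \<chi> T)) \<in> (S \<union> T \<rightarrow>\<^sub>E U) \<rightarrow> (S \<rightarrow>\<^sub>E U) \<times> (T \<rightarrow>\<^sub>E U)"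
      by (auto simp: PiE_iff extensional_def)
    show "(restrict (?m p) S, restrict (?m p) T) = p" if "p \<in> (S \<rightarrow>\<^sub>E U) \<times> (T \<rightarrow>\<^sub>E U)" for p
      using that assms(3) by (auto simp: PiE_iff extensional_def fun_eq_iff restrict_def)
    show "?m (restrict \<chi> S, restrict \<chi> T) = \<chi>" if "\<chi> \<in> S \<union> T \<rightarrow>\<^sub>E U" for \<chi>
      using that by (auto simp: PiE_iff extensional_def fun_eq_iff restrict_def)
  qed
  have w: "(\<Prod>x\<in>S \<union> T. w (?m (\<phi>, \<psi>) x)) = (\<Prod>x\<in>S. w (\<phi> x)) * (\<Prod>x\<in>T. w (\<psi> x))" for \<phi> \<psi>
  proof -
    have "(\<Prod>x\<in>T. w (?m (\<phi>, \<psi>) x)) = (\<Prod>x\<in>T. w (\<psi> x))"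
      using assms(3) by (intro prod.cong) auto
    then show ?thesis using assms by (simp add: prod.union_disjoint)
  qed
  have "expec w U (S \<union> T) g
      = (\<Sum>p\<in>(S \<rightarrow>\<^sub>E U) \<times> (T \<rightarrow>\<^sub>E U). (\<Prod>x\<in>S \<union> T. w (?m p x)) * g (?m p))"
    unfolding expec_def by (rule sum.reindex_bij_betw[OF bij, symmetric])
  also have "\<dots> = (\<Sum>\<phi>\<in>S \<rightarrow>\<^sub>E U. \<Sum>\<psi>\<in>T \<rightarrow>\<^sub>E U. (\<Prod>x\<in>S \<union> T. w (?m (\<phi>, \<psi>) x)) * g (?m (\<phi>, \<psi>)))"
    by (subst sum.cartesian_product, rule sum.cong[OF refl]) (simp only: split_beta prod.collapse fst_conv snd_conv)
  also have "\<dots> = expec w U S (\<lambda>\<phi>. expec w U T (\<lambda>\<psi>. g (?m (\<phi>, \<psi>))))"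
    unfolding w by (simp add: expec_def sum_distrib_left mult_ac)
  finally show ?thesis by simp
qed

text \<open>The images of the points outside \<open>S\<close> integrate out to the total weight
  1.\<close>

lemma expec_superset:
  assumes "finite T" "S \<subseteq> T" "finite U" "sum w U = 1"
    and g: "\<And>\<phi> \<phi>'. (\<And>x. x \<in> S \<Longrightarrow> \<phi> x = \<phi>' x) \<Longrightarrow> g \<phi> = g \<phi>'"
  shows "expec w U T g = expec w U S g"
proof -
  have fin: "finite S" "finite (T - S)" using assms finite_subset by auto
  have "expec w U (S \<union> (T - S)) g
      = expec w U S (\<lambda>\<phi>. expec w U (T - S) (\<lambda>\<psi>. g (\<lambda>x. if x \<in> S then \<phi> x else \<psi> x)))"
    using fin by (intro expec_Un) auto
  also have "\<dots> = expec w U S (\<lambda>\<phi>. expec w U (T - S) (\<lambda>\<psi>. g \<phi>))"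
    by (intro expec_cong g) auto
  also have "\<dots> = expec w U S g"
    using fin assms(3,4) by (simp add: expec_const)
  also have "S \<union> (T - S) = T" using assms(2) by blast
  finally show ?thesis .
qed

text \<open>Substitution along \<open>f\<close>. The composite of an extensional map with
  \<open>f\<close> need not be extensional on \<open>S\<close>; the last premise bridges this
  gap.\<close>

lemma expec_image:
  assumes "inj_on f S"
    and h: "\<And>\<phi>. g \<phi> = h (\<lambda>x. \<phi> (f x))"
    and hc: "\<And>\<phi> \<phi>'. (\<And>x. x \<in> S \<Longrightarrow> \<phi> x = \<phi>' x) \<Longrightarrow> h \<phi> = h \<phi>'"
  shows "expec w U (f ` S) g = expec w U S h"
proof -
  let ?m = "\<lambda>\<phi> x. if x \<in> S then \<phi> (f x) else undefined"
  let ?n = "\<lambda>\<phi> y. if y \<in> f ` S then \<phi> (inv_into S f y) else undefined"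
  have bij: "bij_betw ?m (f ` S \<rightarrow>\<^sub>E U) (S \<rightarrow>\<^sub>E U)"
  proof (rule bij_betwI)
    show "?m \<in> (f ` S \<rightarrow>\<^sub>E U) \<rightarrow> (S \<rightarrow>\<^sub>E U)" by (auto simp: PiE_iff extensional_def)
    show "?n \<in> (S \<rightarrow>\<^sub>E U) \<rightarrow> (f ` S \<rightarrow>\<^sub>E U)"
      using assms(1) by (auto simp: PiE_iff extensional_def)
    show "?n (?m \<phi>) = \<phi>" if "\<phi> \<in> f ` S \<rightarrow>\<^sub>E U" for \<phi>
      using that assms(1) by (auto simp: PiE_iff extensional_def fun_eq_iff)
    show "?m (?n \<phi>) = \<phi>" if "\<phi> \<in> S \<rightarrow>\<^sub>E U" for \<phi>
      using that assms(1) by (auto simp: PiE_iff extensional_def fun_eq_iff)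
  qed
  have "expec w U S h = (\<Sum>\<phi>\<in>f ` S \<rightarrow>\<^sub>E U. (\<Prod>x\<in>S. w (?m \<phi> x)) * h (?m \<phi>))"
    unfolding expec_def by (rule sum.reindex_bij_betw[OF bij, symmetric])
  also have "\<dots> = (\<Sum>\<phi>\<in>f ` S \<rightarrow>\<^sub>E U. (\<Prod>y\<in>f ` S. w (\<phi> y)) * g \<phi>)"
    by (intro sum.cong arg_cong2[where f = "(*)"] refl)
       (auto simp: h prod.reindex[OF assms(1)] intro!: hc)
  finally show ?thesis by (simp add: expec_def)
qed

section \<open>Blending a profile with a graph\<close>

text \<open>
  Think of \<open>v\<close> as the densities of a graphon. \<open>blend v D F s\<close> gives the densities of its disjoint
  union, scaled to mass \<open>1 - s\<close>, with the graph with vertex set \<open>D\<close> and edge set \<open>F\<close>, scaled to mass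
  \<open>s\<close>: a random map sends a vertex to the graphon (\<open>None\<close>) or to a vertex in \<open>D\<close>.
\<close>

definition map_density ::
  "(plgraph \<Rightarrow> real) \<Rightarrow> vert option set set \<Rightarrow> (vert \<Rightarrow> vert option) \<Rightarrow> vert set set \<Rightarrow> real" where
  "map_density v F \<phi> E = (if (`) \<phi> ` E \<subseteq> insert {None} F
     then eval_graph v (unlabel (abs_plgraph {e \<in> E. \<phi> ` e = {None}})) else 0)"

definition blend_weight :: "real \<Rightarrow> vert set \<Rightarrow> vert option \<Rightarrow> real" where
  "blend_weight s D u = (case u of None \<Rightarrow> 1 - s | Some _ \<Rightarrow> s / real (card D))"

definition blend ::
  "(plgraph \<Rightarrow> real) \<Rightarrow> vert set \<Rightarrow> vert option set set \<Rightarrow> real \<Rightarrow> vert set set \<Rightarrow> real" where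
  "blend v D F s E =
     expec (blend_weight s D) (insert None (Some ` D)) (\<Union>E) (\<lambda>\<phi>. map_density v F \<phi> E)"

lemma sum_blend_weight:
  assumes "finite D" "D \<noteq> {}"
  shows "sum (blend_weight s D) (insert None (Some ` D)) = 1"
proof -
  have "sum (blend_weight s D) (Some ` D) = s"
    using assms by (simp add: sum.reindex blend_weight_def)
  then show ?thesis using assms by (simp add: blend_weight_def)
qed

lemma map_density_cong:
  assumes "\<And>x. x \<in> \<Union>E \<Longrightarrow> \<phi> x = \<phi>' x"
  shows "map_density v F \<phi> E = map_density v F \<phi>' E"
proof -
  have "\<phi> ` e = \<phi>' ` e" if "e \<in> E" for e
    using that assms by (intro image_cong) auto
  then have "(`) \<phi> ` E = (`) \<phi>' ` E" "{e \<in> E. \<phi> ` e = {None}} = {e \<in> E. \<phi>' ` e = {None}}"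
    by auto
  then show ?thesis by (simp add: map_density_def)
qed

lemma map_density_image:
  assumes "is_plgraph E" "inj_on f (\<Union>E)" "Lab 0 \<notin> f ` \<Union>E"
  shows "map_density v F \<phi> ((`) f ` E) = map_density v F (\<lambda>x. \<phi> (f x)) E"
proof -
  let ?E = "{e \<in> E. (\<lambda>x. \<phi> (f x)) ` e = {None}}"
  have "{e \<in> (`) f ` E. \<phi> ` e = {None}} = (`) f ` ?E" by (auto simp: image_image)
  moreover have "unlabel (abs_plgraph ((`) f ` ?E)) = unlabel (abs_plgraph ?E)"
    by (rule unlabel_abs_image) (use assms in \<open>auto intro: is_plgraph_subset inj_on_subset\<close>)
  ultimately show ?thesis by (simp add: map_density_def image_image)
qed

text \<open>Averaging over all maps makes the names of the vertices irrelevant. As \<open>f\<close>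
  may alter labels, \<open>blend\<close> does not see labels either;
  \<open>blend_in_sos_profile\<close> uses this for \<open>drop_label\<close>.\<close>

lemma blend_image:
  assumes "is_plgraph E" "inj_on f (\<Union>E)" "Lab 0 \<notin> f ` \<Union>E"
  shows "blend v D F s ((`) f ` E) = blend v D F s E"
proof -
  have U: "\<Union>((`) f ` E) = f ` \<Union>E" by blast
  show ?thesis unfolding blend_def U
    by (rule expec_image[OF assms(2)], rule map_density_image[OF assms], rule map_density_cong, blast)
qed

lemma map_density_Un:
  assumes "is_plgraph E" "is_plgraph E'" "\<Union>E \<inter> \<Union>E' = {}"
  shows "map_density v F \<phi> (E \<union> E') = map_density v F \<phi> E * map_density v F \<phi> E'"
proof -
  let ?N = "\<lambda>E. {e \<in> E. \<phi> ` e = {None}}"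
  have N: "?N (E \<union> E') = ?N E \<union> ?N E'"
    by (rule set_eqI) (simp only: mem_Collect_eq Un_iff conj_disj_distribR)
  have g: "is_plgraph (?N E)" "is_plgraph (?N E')"
    by (rule is_plgraph_subset[OF assms(1)], blast, rule is_plgraph_subset[OF assms(2)], blast)
  let ?d = "\<lambda>E. (`) drop_label ` E"
  have "\<Union>(?d X) \<inter> \<Union>(?d Y) = {}" if "X \<subseteq> E" "Y \<subseteq> E'" for X Y
  proof -
    have "\<Union>(?d X) \<inter> \<Union>(?d Y) = drop_label ` (\<Union>X \<inter> \<Union>Y)" by (auto intro!: imageI)
    also have "\<Union>X \<inter> \<Union>Y = {}" using that assms(3) by blast
    finally show ?thesis by simp
  qed
  from this[of "?N E" "?N E'"] have "\<Union>(?d (?N E)) \<inter> \<Union>(?d (?N E')) = {}"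
    by (simp only: Collect_subset)
  then have "eval_graph v (abs_plgraph (?d (?N E) \<union> ?d (?N E')))
      = eval_graph v (abs_plgraph (?d (?N E))) * eval_graph v (abs_plgraph (?d (?N E')))"
    using g by (intro eval_graph_Un is_plgraph_drop_label)
  then have "eval_graph v (unlabel (abs_plgraph (?N (E \<union> E'))))
      = eval_graph v (unlabel (abs_plgraph (?N E))) * eval_graph v (unlabel (abs_plgraph (?N E')))"
    unfolding N using g by (simp add: plgraph_abs_simps is_plgraph_Un image_Un)
  then show ?thesis by (auto simp: map_density_def image_Un)
qed

text \<open>Vertex-disjoint parts are mapped independently, so the expectation of the product
  splits.\<close>

lemma blend_Un:
  assumes "is_plgraph E" "is_plgraph E'" "\<Union>E \<inter> \<Union>E' = {}"
  shows "blend v D F s (E \<union> E') = blend v D F s E * blend v D F s E'"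
proof -
  let ?w = "blend_weight s D" and ?U = "insert None (Some ` D)"
  let ?m = "\<lambda>\<phi> \<psi> x. if x \<in> \<Union>E then \<phi> x else \<psi> x"
  have "blend v D F s (E \<union> E') = expec ?w ?U (\<Union>E) (\<lambda>\<phi>. expec ?w ?U (\<Union>E')
      (\<lambda>\<psi>. map_density v F (?m \<phi> \<psi>) (E \<union> E')))"
    unfolding blend_def Union_Un_distrib
    by (rule expec_Un) (use assms in \<open>auto intro: is_plgraph_finite_verts simp del: Union_iff\<close>)
  also have "\<dots> = expec ?w ?U (\<Union>E) (\<lambda>\<phi>. expec ?w ?U (\<Union>E')
      (\<lambda>\<psi>. map_density v F \<phi> E * map_density v F \<psi> E'))"
  proof (intro expec_cong)
    fix \<phi> \<psi>
    have "map_density v F (?m \<phi> \<psi>) E = map_density v F \<phi> E"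
      "map_density v F (?m \<phi> \<psi>) E' = map_density v F \<psi> E'"
      by (rule map_density_cong; use assms(3) in fastforce)+
    then show "map_density v F (?m \<phi> \<psi>) (E \<union> E') = map_density v F \<phi> E * map_density v F \<psi> E'"
      by (simp add: map_density_Un[OF assms])
  qed
  also have "\<dots> = blend v D F s E * blend v D F s E'"
    by (simp only: expec_cmult expec_multc blend_def)
  finally show ?thesis .
qed

lemma blend_empty: "blend v D F s {} = 1"
  by (simp add: blend_def expec_def map_density_def eval_graph_0 zero_plgraph_def[symmetric])

text \<open>Multiplicativity over components carries values from connected graphs to all graphs.
  \<open>rep_plgraph\<close> enters because coordinates are indexed by isomorphism classes, whereas
  \<open>blend\<close> acts on edge sets.\<close>

lemma eval_graph_blend:
  assumes "is_plgraph E" and "\<And>C. C \<in> edge_components E \<Longrightarrow> v' (abs_plgraph C) = blend v D F s (rep_plgraph (abs_plgraph C))"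
  shows "eval_graph v' (abs_plgraph E) = blend v D F s E"
proof -
  have "blend v D F s (rep_plgraph (abs_plgraph C)) = blend v D F s C" if "C \<in> edge_components E" for C
  proof -
    have "is_plgraph C" using assms(1) edge_component_subset[OF that] is_plgraph_subset by blast
    then have "plgraph_iso C (rep_plgraph (abs_plgraph C))"
      using Quotient3_rep_abs[OF Quotient3_plgraph] plgraph_iso_sym plgraph_iso_refl by blast
    then obtain f where f: "is_plgraph C" "is_plgraph (rep_plgraph (abs_plgraph C))" "inj_on f (\<Union>C)"
      "rep_plgraph (abs_plgraph C) = (`) f ` C"
      by (rule plgraph_isoE) blast
    moreover have "Lab 0 \<notin> f ` \<Union>C" using is_plgraph_Lab0[OF f(2)] unfolding f(4) by blast
    ultimately show ?thesis using blend_image[of C f v D F s] by simp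
  qed
  then show ?thesis
    using assms(2) by (simp add: eval_graph_abs[OF assms(1)]
      prod_edge_components[OF assms(1), of "blend v D F s"] blend_empty blend_Un)
qed

section \<open>Positivity of the blend\<close>

definition graphon_part :: "(vert \<Rightarrow> vert option) \<Rightarrow> vert set set \<Rightarrow> vert set set" where
  "graphon_part \<phi> E = {e \<in> E. \<phi> ` e = {None}}"

text \<open>The graphon parts keep their labels and are glued along them before \<open>v\<close> is
  applied. The conditions on the images of edges are separate factors, so that each can join the
  coefficient of its own graph in a square.\<close>

definition glue_density :: "(plgraph \<Rightarrow> real) \<Rightarrow> vert option set set \<Rightarrow> vert set set \<Rightarrow> vert set set \<Rightarrow>
    (vert \<Rightarrow> vert option) \<Rightarrow> (vert \<Rightarrow> vert option) \<Rightarrow> real" where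
  "glue_density v F A B \<phi> \<psi> =
     of_bool ((`) \<phi> ` A \<subseteq> insert {None} F) * of_bool ((`) \<psi> ` B \<subseteq> insert {None} F) *
     eval_graph v (unlabel (abs_plgraph (graphon_part \<phi> A) + abs_plgraph (graphon_part \<psi> B)))"

lemma is_plgraph_graphon_part: "is_plgraph E \<Longrightarrow> is_plgraph (graphon_part \<phi> E)"
  unfolding graphon_part_def by (erule is_plgraph_subset) auto

lemma map_density_glue:
  assumes "is_plgraph A" "is_plgraph B"
  shows "map_density v F \<chi> (glue A B) = glue_density v F A B (\<chi> \<circ> shiftL) (\<chi> \<circ> shiftR)"
proof -
  have "{e \<in> glue A B. \<chi> ` e = {None}} = glue (graphon_part (\<chi> \<circ> shiftL) A) (graphon_part (\<chi> \<circ> shiftR) B)"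
    by (auto simp: glue_def graphon_part_def image_comp)
  moreover have "(`) \<chi> ` glue A B = (`) (\<chi> \<circ> shiftL) ` A \<union> (`) (\<chi> \<circ> shiftR) ` B"
    by (simp add: glue_def image_Un image_image)
  ultimately show ?thesis using assms
    by (simp add: map_density_def glue_density_def plgraph_abs_simps is_plgraph_graphon_part)
qed

lemma glue_density_cong:
  assumes "\<And>x. x \<in> \<Union>A \<Longrightarrow> \<phi> x = \<phi>' x" "\<And>x. x \<in> \<Union>B \<Longrightarrow> \<psi> x = \<psi>' x"
  shows "glue_density v F A B \<phi> \<psi> = glue_density v F A B \<phi>' \<psi>'"
proof -
  have *: "(`) \<phi> ` A = (`) \<phi>' ` A \<and> graphon_part \<phi> A = graphon_part \<phi>' A"
    if "\<And>x. x \<in> \<Union>A \<Longrightarrow> \<phi> x = \<phi>' x" for \<phi> \<phi>' and A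
  proof -
    have "\<phi> ` e = \<phi>' ` e" if "e \<in> A" for e
      using that \<open>\<And>x. x \<in> \<Union>A \<Longrightarrow> \<phi> x = \<phi>' x\<close> by (intro image_cong) auto
    then show ?thesis by (auto simp: graphon_part_def)
  qed
  show ?thesis using *[OF assms(1)] *[OF assms(2)] by (simp add: glue_density_def)
qed

text \<open>Conditioned on the images of the labeled vertices, the two factors are mapped independently.\<close>

lemma blend_glue:
  fixes s :: real
  assumes A: "is_plgraph A" "\<Union>A \<subseteq> Q" and B: "is_plgraph B" "\<Union>B \<subseteq> Q"
    and Q: "finite Q" and D: "finite D" "D \<noteq> {}"
  defines "L \<equiv> Q \<inter> range Lab" and "M \<equiv> Q - range Lab"
    and "w \<equiv> blend_weight s D" and "U \<equiv> insert None (Some ` D)"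
  shows "blend v D F s (glue A B) = expec w U L (\<lambda>\<psi>. expec w U M (\<lambda>\<phi>. expec w U M (\<lambda>\<phi>'.
    glue_density v F A B (\<lambda>x. if x \<in> L then \<psi> x else \<phi> x) (\<lambda>x. if x \<in> L then \<psi> x else \<phi>' x))))"
proof -
  let ?G = "glue A B"
  have U: "finite U" "sum w U = 1" using D sum_blend_weight by (auto simp: U_def w_def)
  have fin: "finite L" "finite M" using Q by (auto simp: L_def M_def)
  have LM: "Q = L \<union> M" by (auto simp: L_def M_def)
  have sL: "shiftL x = x" "shiftR x = x" if "x \<in> L" for x using that by (auto simp: L_def)
  have sM: "shiftL x \<notin> L" "shiftR x \<notin> L" "shiftL x \<in> shiftL ` M" "shiftR x \<in> shiftR ` M"
    "shiftR x \<notin> shiftL ` M" if "x \<in> M" for x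
    using that by (auto simp: L_def M_def shiftR_eq_shiftL_iff)
  have nLM: "x \<notin> L" if "x \<in> M" for x using that by (auto simp: L_def M_def)
  \<comment> \<open>Labeled vertices occur once in the glued graph, unlabeled ones in a left and a
    right copy.\<close>
  have sub: "\<Union>?G \<subseteq> L \<union> (shiftL ` M \<union> shiftR ` M)"
    using A(2) B(2) sL unfolding Union_glue LM by (auto 0 4 intro: rev_image_eqI)
  have dis: "L \<inter> (shiftL ` M \<union> shiftR ` M) = {}" "shiftL ` M \<inter> shiftR ` M = {}"
    using sM by (auto, metis imageI)
  let ?\<chi> = "\<lambda>\<psi> \<alpha> \<beta> x. if x \<in> L then \<psi> x else if x \<in> shiftL ` M then \<alpha> x else \<beta> x"
  let ?h = "\<lambda>\<psi> \<phi> \<phi>'. glue_density v F A B (\<lambda>x. if x \<in> L then \<psi> x else \<phi> x) (\<lambda>x. if x \<in> L then \<psi> x else \<phi>' x)"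
  have key: "map_density v F (?\<chi> \<psi> \<alpha> \<beta>) ?G = ?h \<psi> (\<lambda>x. \<alpha> (shiftL x)) (\<lambda>x. \<beta> (shiftR x))" for \<psi> \<alpha> \<beta>
    unfolding map_density_glue[OF A(1) B(1)]
  proof (rule glue_density_cong)
    fix x assume "x \<in> \<Union>A"
    then have "x \<in> L \<or> x \<in> M" using A(2) LM by blast
    then show "(?\<chi> \<psi> \<alpha> \<beta> \<circ> shiftL) x = (if x \<in> L then \<psi> x else \<alpha> (shiftL x))"
      using sL sM nLM by (elim disjE) simp_all
  next
    fix x assume "x \<in> \<Union>B"
    then have "x \<in> L \<or> x \<in> M" using B(2) LM by blast
    then show "(?\<chi> \<psi> \<alpha> \<beta> \<circ> shiftR) x = (if x \<in> L then \<psi> x else \<beta> (shiftR x))"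
      using sL sM nLM by (elim disjE) simp_all
  qed
  have hcong: "?h \<psi> \<phi> \<phi>' = ?h \<psi> \<eta> \<eta>'"
    if "\<And>x. x \<in> M \<Longrightarrow> \<phi> x = \<eta> x" "\<And>x. x \<in> M \<Longrightarrow> \<phi>' x = \<eta>' x" for \<psi> \<phi> \<phi>' \<eta> \<eta>'
    by (rule glue_density_cong) (use A(2) B(2) LM that in auto)
  \<comment> \<open>Mapping all of \<open>Q\<close>, and not only the vertices of \<open>A\<close>
    and \<open>B\<close>, gives every pair of graphs the same sample space, as the sum over pairs in
    \<open>blend_positive\<close> requires.\<close>
  have "blend v D F s ?G = expec w U (L \<union> (shiftL ` M \<union> shiftR ` M)) (\<lambda>\<chi>. map_density v F \<chi> ?G)"
    unfolding blend_def w_def[symmetric] U_def[symmetric]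
    by (rule expec_superset[symmetric])
       (use sub fin U in \<open>auto intro: map_density_cong simp del: Union_iff\<close>)
  also have "\<dots> = expec w U L (\<lambda>\<psi>. expec w U (shiftL ` M \<union> shiftR ` M)
      (\<lambda>\<chi>. map_density v F (\<lambda>x. if x \<in> L then \<psi> x else \<chi> x) ?G))"
    by (rule expec_Un) (use fin dis in auto)
  also have "\<dots> = expec w U L (\<lambda>\<psi>. expec w U (shiftL ` M) (\<lambda>\<alpha>. expec w U (shiftR ` M)
      (\<lambda>\<beta>. map_density v F (?\<chi> \<psi> \<alpha> \<beta>) ?G)))"
    by (rule expec_cong, rule expec_Un) (use fin dis in auto)
  also have "\<dots> = expec w U L (\<lambda>\<psi>. expec w U (shiftL ` M) (\<lambda>\<alpha>. expec w U M (\<lambda>\<phi>'. ?h \<psi> (\<lambda>x. \<alpha> (shiftL x)) \<phi>')))"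
    unfolding key
    by (intro expec_cong expec_image) (auto simp: inj_on_def intro!: hcong)
  also have "\<dots> = expec w U L (\<lambda>\<psi>. expec w U M (\<lambda>\<phi>. expec w U M (\<lambda>\<phi>'. ?h \<psi> \<phi> \<phi>')))"
    by (rule expec_cong, rule expec_image) (auto simp: inj_on_def intro!: expec_cong hcong)
  finally show ?thesis .
qed

text \<open>For fixed images \<open>\<psi>\<close> of the labeled vertices, the double sum is the
  value at \<open>v\<close> of a single square, with one term for each graph of \<open>p\<close> and
  each map of the unlabeled vertices. Averaging over \<open>\<psi>\<close> keeps the sign.\<close>

lemma blend_positive:
  assumes D: "finite D" "D \<noteq> {}" and s: "0 \<le> s" "s \<le> 1"
    and pos: "\<And>p. (\<forall>G\<in>Poly_Mapping.keys p. num_edges G \<le> d) \<Longrightarrow> eval_comb v (unlabel_comb (p\<^sup>2)) \<ge> 0"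
    and p: "\<And>G. G \<in> Poly_Mapping.keys p \<Longrightarrow> num_edges G \<le> d"
  shows "(\<Sum>A\<in>Poly_Mapping.keys p. \<Sum>B\<in>Poly_Mapping.keys p. Poly_Mapping.lookup p A * Poly_Mapping.lookup p B *
    blend v D F s (glue (rep_plgraph A) (rep_plgraph B))) \<ge> 0"
proof -
  let ?K = "Poly_Mapping.keys p" and ?c = "Poly_Mapping.lookup p"
  define Q where "Q = (\<Union>A\<in>?K. \<Union>(rep_plgraph A))"
  have Q: "finite Q" unfolding Q_def by (auto simp del: Union_iff intro!: is_plgraph_finite_verts)
  define L where "L = Q \<inter> range Lab"
  define M where "M = Q - range Lab"
  define w where "w = blend_weight s D"
  define U where "U = insert None (Some ` D)"
  have w: "w u \<ge> 0" for u using s by (auto simp: w_def blend_weight_def split: option.splits)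
  define W where "W \<phi> = (\<Prod>x\<in>M. w (\<phi> x))" for \<phi>
  define m where "m \<psi> \<phi> x = (if x \<in> L then \<psi> x else \<phi> x)" for \<psi> \<phi> :: "vert \<Rightarrow> vert option" and x
  \<comment> \<open>The coefficient absorbs the weight of the map \<open>\<phi>\<close> and the
    condition that every edge goes to \<open>{None}\<close> or into \<open>F\<close>.\<close>
  define c where "c \<psi> = (\<lambda>(A, \<phi>). ?c A * W \<phi> * of_bool ((`) (m \<psi> \<phi>) ` rep_plgraph A \<subseteq> insert {None} F))" for \<psi>
  define g where "g \<psi> = (\<lambda>(A, \<phi>). abs_plgraph (graphon_part (m \<psi> \<phi>) (rep_plgraph A)))" for \<psi>
  let ?I = "?K \<times> (M \<rightarrow>\<^sub>E U)"
  \<comment> \<open>Passing to the graphon part only deletes edges, so the new square is again of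
    level \<open>d\<close>.\<close>
  have gd: "num_edges (g \<psi> i) \<le> d" if iI: "i \<in> ?I" for \<psi> i
  proof -
    obtain A \<phi> where i: "i = (A, \<phi>)" "A \<in> ?K" using iI by auto
    have "card (graphon_part (m \<psi> \<phi>) (rep_plgraph A)) \<le> card (rep_plgraph A)"
      by (rule card_mono) (auto simp: is_plgraph_finite graphon_part_def)
    also have "\<dots> \<le> d" using p[OF i(2)] by (simp add: num_edges_rep)
    finally show ?thesis by (simp add: i g_def plgraph_abs_simps is_plgraph_graphon_part)
  qed
  have nonneg: "(\<Sum>i\<in>?I. \<Sum>j\<in>?I. c \<psi> i * c \<psi> j * eval_graph v (unlabel (g \<psi> i + g \<psi> j))) \<ge> 0" for \<psi>
  proof -
    let ?q = "\<Sum>i\<in>?I. Poly_Mapping.single (g \<psi> i) (c \<psi> i)"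
    have "Poly_Mapping.keys ?q \<subseteq> (\<Union>i\<in>?I. Poly_Mapping.keys (Poly_Mapping.single (g \<psi> i) (c \<psi> i)))"
      by (rule keys_sum)
    then have "\<forall>G\<in>Poly_Mapping.keys ?q. num_edges G \<le> d"
      using gd by (fastforce split: if_splits)
    from pos[OF this] show ?thesis by (simp add: eval_comb_unlabel_square)
  qed
  have eq: "blend v D F s (glue (rep_plgraph A) (rep_plgraph B)) = expec w U L (\<lambda>\<psi>. \<Sum>\<phi>\<in>M \<rightarrow>\<^sub>E U. \<Sum>\<phi>'\<in>M \<rightarrow>\<^sub>E U.
      W \<phi> * (W \<phi>' * glue_density v F (rep_plgraph A) (rep_plgraph B) (m \<psi> \<phi>) (m \<psi> \<phi>')))"
    if "A \<in> ?K" "B \<in> ?K" for A B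
  proof -
    have "\<Union>(rep_plgraph A) \<subseteq> Q" "\<Union>(rep_plgraph B) \<subseteq> Q" using that by (auto simp: Q_def)
    note bg = blend_glue[OF is_plgraph_rep this(1) is_plgraph_rep this(2) Q D, of v F s]
    show ?thesis
      unfolding bg L_def[symmetric] M_def[symmetric] w_def[symmetric] U_def[symmetric] m_def
      by (rule expec_cong) (simp add: expec_def W_def sum_distrib_left)
  qed
  have "(\<Sum>A\<in>?K. \<Sum>B\<in>?K. ?c A * ?c B * blend v D F s (glue (rep_plgraph A) (rep_plgraph B)))
      = (\<Sum>A\<in>?K. \<Sum>B\<in>?K. expec w U L (\<lambda>\<psi>. ?c A * ?c B * (\<Sum>\<phi>\<in>M \<rightarrow>\<^sub>E U. \<Sum>\<phi>'\<in>M \<rightarrow>\<^sub>E U.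
      W \<phi> * (W \<phi>' * glue_density v F (rep_plgraph A) (rep_plgraph B) (m \<psi> \<phi>) (m \<psi> \<phi>')))))"
    by (intro sum.cong refl) (simp add: eq expec_cmult)
  also have "\<dots> = expec w U L (\<lambda>\<psi>. \<Sum>A\<in>?K. \<Sum>B\<in>?K. ?c A * ?c B * (\<Sum>\<phi>\<in>M \<rightarrow>\<^sub>E U. \<Sum>\<phi>'\<in>M \<rightarrow>\<^sub>E U.
      W \<phi> * (W \<phi>' * glue_density v F (rep_plgraph A) (rep_plgraph B) (m \<psi> \<phi>) (m \<psi> \<phi>'))))"
    unfolding expec_def sum_distrib_left[of "\<Prod>x\<in>L. _ x"]
    by (subst (2) sum.swap) (auto intro!: sum.cong simp: sum.swap[of _ "L \<rightarrow>\<^sub>E U" ?K])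
  also have "\<dots> = expec w U L (\<lambda>\<psi>. \<Sum>i\<in>?I. \<Sum>j\<in>?I. c \<psi> i * c \<psi> j * eval_graph v (unlabel (g \<psi> i + g \<psi> j)))"
  proof (rule expec_cong)
    fix \<psi>
    have "(\<Sum>i\<in>?I. \<Sum>j\<in>?I. c \<psi> i * c \<psi> j * eval_graph v (unlabel (g \<psi> i + g \<psi> j)))
      = (\<Sum>A\<in>?K. \<Sum>\<phi>\<in>M \<rightarrow>\<^sub>E U. \<Sum>B\<in>?K. \<Sum>\<phi>'\<in>M \<rightarrow>\<^sub>E U.
        c \<psi> (A, \<phi>) * c \<psi> (B, \<phi>') * eval_graph v (unlabel (g \<psi> (A, \<phi>) + g \<psi> (B, \<phi>'))))"
      by (simp add: sum.cartesian_product')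
    also have "\<dots> = (\<Sum>A\<in>?K. \<Sum>B\<in>?K. \<Sum>\<phi>\<in>M \<rightarrow>\<^sub>E U. \<Sum>\<phi>'\<in>M \<rightarrow>\<^sub>E U.
        c \<psi> (A, \<phi>) * c \<psi> (B, \<phi>') * eval_graph v (unlabel (g \<psi> (A, \<phi>) + g \<psi> (B, \<phi>'))))"
      by (intro sum.cong refl) (rule sum.swap)
    also have "\<dots> = (\<Sum>A\<in>?K. \<Sum>B\<in>?K. ?c A * ?c B * (\<Sum>\<phi>\<in>M \<rightarrow>\<^sub>E U. \<Sum>\<phi>'\<in>M \<rightarrow>\<^sub>E U.
        W \<phi> * (W \<phi>' * glue_density v F (rep_plgraph A) (rep_plgraph B) (m \<psi> \<phi>) (m \<psi> \<phi>'))))"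
      unfolding sum_distrib_left
      by (intro sum.cong refl) (simp add: c_def g_def glue_density_def)
    finally show "(\<Sum>A\<in>?K. \<Sum>B\<in>?K. ?c A * ?c B * (\<Sum>\<phi>\<in>M \<rightarrow>\<^sub>E U. \<Sum>\<phi>'\<in>M \<rightarrow>\<^sub>E U.
        W \<phi> * (W \<phi>' * glue_density v F (rep_plgraph A) (rep_plgraph B) (m \<psi> \<phi>) (m \<psi> \<phi>'))))
      = (\<Sum>i\<in>?I. \<Sum>j\<in>?I. c \<psi> i * c \<psi> j * eval_graph v (unlabel (g \<psi> i + g \<psi> j)))" by simp
  qed
  also have "\<dots> \<ge> 0" using w nonneg by (intro expec_nonneg)
  finally show ?thesis .
qed

section \<open>The blend as a polynomial in the scale, and its values at both ends\<close>

lemma blend_poly: "\<exists>q. \<forall>s. blend v D F s E = poly q s"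
proof -
  define W where "W u = (case u of None \<Rightarrow> [:1, -1:] | Some _ \<Rightarrow> [:0, 1 / real (card D):])"
    for u :: "vert option"
  have W: "blend_weight s D u = poly (W u) s" for s u
    by (simp add: blend_weight_def W_def split: option.split)
  have "blend v D F s E = poly (\<Sum>\<phi>\<in>\<Union>E \<rightarrow>\<^sub>E insert None (Some ` D).
      (\<Prod>x\<in>\<Union>E. W (\<phi> x)) * [:map_density v F \<phi> E:]) s" for s
    by (simp add: blend_def expec_def poly_sum poly_prod W mult.commute)
  then show ?thesis by blast
qed

text \<open>Only the map that is constantly \<open>None\<close> has nonzero weight.\<close>

lemma blend_at_0:
  assumes E: "is_plgraph E" and D: "finite D"
  shows "blend v D F 0 E = eval_graph v (unlabel (abs_plgraph E))"
proof -
  let ?U = "insert None (Some ` D)" and ?V = "\<Union>E"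
  define \<phi>0 :: "vert \<Rightarrow> vert option" where "\<phi>0 = restrict (\<lambda>_. None) ?V"
  have fin: "finite ?V" using E by (rule is_plgraph_finite_verts)
  have "blend v D F 0 E = (\<Sum>\<phi>\<in>{\<phi>0}. (\<Prod>x\<in>?V. blend_weight 0 D (\<phi> x)) * map_density v F \<phi> E)"
    unfolding blend_def expec_def
  proof (rule sum.mono_neutral_right)
    show "finite (?V \<rightarrow>\<^sub>E ?U)" using fin D by (intro finite_PiE) auto
    show "{\<phi>0} \<subseteq> ?V \<rightarrow>\<^sub>E ?U" by (auto simp: \<phi>0_def)
    show "\<forall>\<phi>\<in>(?V \<rightarrow>\<^sub>E ?U) - {\<phi>0}. (\<Prod>x\<in>?V. blend_weight 0 D (\<phi> x)) * map_density v F \<phi> E = 0"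
    proof
      fix \<phi> assume \<phi>: "\<phi> \<in> (?V \<rightarrow>\<^sub>E ?U) - {\<phi>0}"
      have "\<exists>x\<in>?V. \<phi> x \<noteq> None"
      proof (rule ccontr)
        assume "\<not> (\<exists>x\<in>?V. \<phi> x \<noteq> None)"
        then have "\<phi> = \<phi>0" using \<phi> by (intro ext) (auto simp: \<phi>0_def restrict_def PiE_iff extensional_def)
        then show False using \<phi> by simp
      qed
      then have "(\<Prod>x\<in>?V. blend_weight 0 D (\<phi> x)) = 0"
        by (intro prod_zero fin) (auto simp: blend_weight_def split: option.splits)
      then show "(\<Prod>x\<in>?V. blend_weight 0 D (\<phi> x)) * map_density v F \<phi> E = 0" by simp
    qed
  qed
  also have "(\<Prod>x\<in>?V. blend_weight 0 D (\<phi>0 x)) = 1"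
    by (rule prod.neutral) (simp add: \<phi>0_def blend_weight_def)
  moreover have "map_density v F \<phi>0 E = eval_graph v (unlabel (abs_plgraph E))"
  proof -
    have *: "\<phi>0 ` e = {None}" if e: "e \<in> E" for e
    proof -
      have "\<phi>0 ` e = (\<lambda>_. None) ` e" using e by (intro image_cong) (auto simp: \<phi>0_def)
      then show ?thesis using is_plgraph_nonempty[OF E e] by auto
    qed
    then have "{e \<in> E. \<phi>0 ` e = {None}} = E" "(`) \<phi>0 ` E \<subseteq> insert {None} F" by auto
    then show ?thesis by (simp add: map_density_def)
  qed
  ultimately show ?thesis by simp
qed

text \<open>\<open>None\<close> has weight 0, and what remains is the homomorphism density into the
  graph with vertex set \<open>D\<close> and edge set \<open>F\<close>, independent of
  \<open>v\<close>.\<close>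

lemma blend_at_1:
  assumes E: "is_plgraph E" and D: "finite D"
  shows "blend v D F 1 E = (\<Sum>\<phi>\<in>\<Union>E \<rightarrow>\<^sub>E Some ` D. (1 / card D) ^ card (\<Union>E) * of_bool ((`) \<phi> ` E \<subseteq> F))"
proof -
  let ?U = "insert None (Some ` D)" and ?V = "\<Union>E"
  have fin: "finite ?V" using E by (rule is_plgraph_finite_verts)
  have "blend v D F 1 E = (\<Sum>\<phi>\<in>?V \<rightarrow>\<^sub>E Some ` D. (\<Prod>x\<in>?V. blend_weight 1 D (\<phi> x)) * map_density v F \<phi> E)"
    unfolding blend_def expec_def
  proof (rule sum.mono_neutral_right)
    show "finite (?V \<rightarrow>\<^sub>E ?U)" using fin D by (intro finite_PiE) auto
    show "?V \<rightarrow>\<^sub>E Some ` D \<subseteq> ?V \<rightarrow>\<^sub>E ?U" by (rule PiE_mono) auto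
    show "\<forall>\<phi>\<in>(?V \<rightarrow>\<^sub>E ?U) - (?V \<rightarrow>\<^sub>E Some ` D).
        (\<Prod>x\<in>?V. blend_weight 1 D (\<phi> x)) * map_density v F \<phi> E = 0"
    proof
      fix \<phi> assume \<phi>: "\<phi> \<in> (?V \<rightarrow>\<^sub>E ?U) - (?V \<rightarrow>\<^sub>E Some ` D)"
      then have "\<exists>x\<in>?V. \<phi> x = None" by (auto simp: PiE_iff)
      then have "(\<Prod>x\<in>?V. blend_weight 1 D (\<phi> x)) = 0"
        by (intro prod_zero fin) (force simp: blend_weight_def)
      then show "(\<Prod>x\<in>?V. blend_weight 1 D (\<phi> x)) * map_density v F \<phi> E = 0" by simp
    qed
  qed
  also have "\<dots> = (\<Sum>\<phi>\<in>?V \<rightarrow>\<^sub>E Some ` D. (1 / card D) ^ card ?V * of_bool ((`) \<phi> ` E \<subseteq> F))"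
  proof (rule sum.cong[OF refl])
    fix \<phi> assume \<phi>: "\<phi> \<in> ?V \<rightarrow>\<^sub>E Some ` D"
    have some: "\<phi> x \<in> Some ` D" if "x \<in> ?V" for x using \<phi> that by (rule PiE_mem)
    have "(\<Prod>x\<in>?V. blend_weight 1 D (\<phi> x)) = (\<Prod>x\<in>?V. 1 / card D)"
      by (rule prod.cong[OF refl]) (drule some, auto simp: blend_weight_def)
    moreover have "map_density v F \<phi> E = of_bool ((`) \<phi> ` E \<subseteq> F)"
    proof -
      have *: "\<phi> ` e \<noteq> {None}" if e: "e \<in> E" for e
      proof -
        obtain x where x: "x \<in> e" using is_plgraph_nonempty[OF E e] by blast
        then have "\<phi> x \<in> Some ` D" using e some by blast
        then have "\<phi> x \<noteq> None" by auto
        then show ?thesis using x by (metis imageI singletonD)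
      qed
      then have none: "{e \<in> E. \<phi> ` e = {None}} = {}" by simp
      have "(`) \<phi> ` E \<subseteq> insert {None} F \<longleftrightarrow> (`) \<phi> ` E \<subseteq> F" using * by auto
      then show ?thesis
        unfolding map_density_def none by (simp add: zero_plgraph_def[symmetric] eval_graph_0)
    qed
    ultimately show "(\<Prod>x\<in>?V. blend_weight 1 D (\<phi> x)) * map_density v F \<phi> E
        = (1 / card D) ^ card ?V * of_bool ((`) \<phi> ` E \<subseteq> F)" by simp
  qed
  finally show ?thesis .
qed

section \<open>Graphs separate graph combinations\<close>

text \<open>Moebius inversion over subsets in the form of an induction: the proper subsets already
  contribute 0.\<close>

lemma zero_of_subset_sums_zero:
  fixes g :: "'a set \<Rightarrow> real"
  assumes "finite F" "\<And>F. finite F \<Longrightarrow> (\<Sum>F'\<in>Pow F. g F') = 0"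
  shows "g F = 0"
  using assms(1)
proof (induction rule: finite_psubset_induct)
  case (psubset F)
  have "(\<Sum>F'\<in>Pow F. g F') = g F + (\<Sum>F'\<in>Pow F - {F}. g F')"
    using psubset.hyps by (intro sum.remove) auto
  moreover have "(\<Sum>F'\<in>Pow F - {F}. g F') = 0"
    by (intro sum.neutral) (use psubset.IH in auto)
  ultimately show ?case using assms(2)[OF psubset.hyps] by simp
qed

text \<open>A map onto the edges of \<open>E0\<close> forces \<open>E\<close> to have at least as
  many edges and vertices as \<open>E0\<close>. The bound on the sum turns both into equalities, so
  \<open>\<phi>\<close> is injective.\<close>

lemma edge_surjection_iso:
  assumes E: "is_plgraph E" "\<And>n. Lab n \<notin> \<Union>E" and E0: "is_plgraph E0" "\<And>n. Lab n \<notin> \<Union>E0"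
    and \<phi>: "(`) \<phi> ` E = (`) Some ` E0"
    and le: "card E + card (\<Union>E) \<le> card E0 + card (\<Union>E0)"
  shows "plgraph_iso E E0"
proof -
  have "inj ((`) (Some :: vert \<Rightarrow> _))" by (auto intro!: injI simp: inj_image_eq_iff)
  then have "card E0 = card ((`) Some ` E0)" by (metis card_image inj_on_subset subset_UNIV)
  also have "\<dots> \<le> card E" unfolding \<phi>[symmetric] by (rule card_image_le) (rule is_plgraph_finite[OF E(1)])
  finally have c1: "card E0 \<le> card E" .
  have U: "\<phi> ` \<Union>E = Some ` \<Union>E0"
  proof -
    have "\<Union>((`) \<phi> ` E) = \<phi> ` \<Union>E" "\<Union>((`) Some ` E0) = Some ` \<Union>E0" by blast+
    then show ?thesis using \<phi> by simp
  qed
  have c2: "card (\<phi> ` \<Union>E) = card (\<Union>E0)" unfolding U by (simp add: card_image)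
  then have "card (\<Union>E0) \<le> card (\<Union>E)"
    using card_image_le[OF is_plgraph_finite_verts[OF E(1)]] by metis
  then have "card (\<phi> ` \<Union>E) = card (\<Union>E)" using c1 c2 le by linarith
  then have inj: "inj_on \<phi> (\<Union>E)"
    by (rule eq_card_imp_inj_on[OF is_plgraph_finite_verts[OF E(1)]])
  show ?thesis
  proof (rule plgraph_isoI[where f = "the \<circ> \<phi>"])
    show "inj_on (the \<circ> \<phi>) (\<Union>E)"
      by (rule comp_inj_on[OF inj]) (auto simp: U inj_on_def)
    have "(the \<circ> \<phi>) ` \<Union>E = \<Union>E0" by (simp only: image_comp[symmetric] U) (simp add: image_image)
    then show "(the \<circ> \<phi>) x = Lab n \<longleftrightarrow> x = Lab n" if "x \<in> \<Union>E" for x n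
      using that E(2) E0(2) by (metis imageI)
    have "(`) (the \<circ> \<phi>) ` E = (`) the ` (`) \<phi> ` E" by (simp add: image_image)
    also have "\<dots> = E0" unfolding \<phi> by (simp add: image_image)
    finally show "E0 = (`) (the \<circ> \<phi>) ` E" by simp
  qed (rule E(1))
qed

text \<open>
  Take a constituent \<open>H\<close> of \<open>b\<close> with the largest number of edges plus vertices. If \<open>b\<close> vanished on
  all subgraphs of \<open>H\<close>, the weighted count of maps from constituents onto the edge set of \<open>H\<close> would
  vanish, but by maximality only automorphisms of \<open>H\<close> contribute to it.
\<close>

lemma blend_separates:
  assumes "unlabeled_comb b" "b \<noteq> 0"
  shows "\<exists>D F. finite D \<and> D \<noteq> {} \<and>
    (\<Sum>H\<in>Poly_Mapping.keys b. Poly_Mapping.lookup b H * blend v D F 1 (rep_plgraph H)) \<noteq> 0"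
proof -
  let ?K = "Poly_Mapping.keys b" and ?c = "Poly_Mapping.lookup b"
  let ?size = "\<lambda>H. card (rep_plgraph H) + card (\<Union>(rep_plgraph H))"
  have "Max (?size ` ?K) \<in> ?size ` ?K" using assms(2) by (intro Max_in) auto
  then obtain H0 where H0: "H0 \<in> ?K" "?size H0 = Max (?size ` ?K)" by auto
  have max: "?size H \<le> ?size H0" if "H \<in> ?K" for H
    unfolding H0(2) using that by (intro Max_ge) auto
  let ?E0 = "rep_plgraph H0"
  \<comment> \<open>\<open>Lab 0\<close> is never a vertex of a graph; it keeps \<open>D\<close>
    nonempty when \<open>H0\<close> is the empty graph.\<close>
  define D where "D = insert (Lab 0) (\<Union>?E0)"
  have D: "finite D" "D \<noteq> {}" using is_plgraph_finite_verts[of ?E0] by (auto simp: D_def simp del: Union_iff)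
  define maps where "maps H = (\<Union>(rep_plgraph H) \<rightarrow>\<^sub>E Some ` D)" for H
  have fin: "finite (maps H)" for H
    unfolding maps_def using D by (intro finite_PiE is_plgraph_finite_verts) auto
  define q where "q H = (1 / real (card D)) ^ card (\<Union>(rep_plgraph H))" for H
  \<comment> \<open>The part of the weighted count with edge image exactly \<open>F\<close>. Summed
    over all subsets of \<open>F\<close>, it gives back \<open>b\<close> at the graph with edge set
    \<open>F\<close>.\<close>
  define g where "g F = (\<Sum>H\<in>?K. ?c H * (\<Sum>\<phi>\<in>maps H. q H * of_bool ((`) \<phi> ` rep_plgraph H = F)))" for F
  show ?thesis
  proof (rule ccontr)
    assume "\<not> ?thesis"
    then have zero: "(\<Sum>H\<in>?K. ?c H * blend v D F 1 (rep_plgraph H)) = 0" for F using D by blast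
    have sums: "(\<Sum>F'\<in>Pow F. g F') = 0" if F: "finite F" for F
    proof -
      have "(\<Sum>F'\<in>Pow F. g F') = (\<Sum>H\<in>?K. \<Sum>F'\<in>Pow F. ?c H * (\<Sum>\<phi>\<in>maps H. q H * of_bool ((`) \<phi> ` rep_plgraph H = F')))"
        unfolding g_def by (rule sum.swap)
      also have "\<dots> = (\<Sum>H\<in>?K. ?c H * (\<Sum>\<phi>\<in>maps H. \<Sum>F'\<in>Pow F. q H * of_bool ((`) \<phi> ` rep_plgraph H = F')))"
        by (intro sum.cong refl) (subst sum.swap, simp only: sum_distrib_left)
      also have "\<dots> = (\<Sum>H\<in>?K. ?c H * (\<Sum>\<phi>\<in>maps H. q H * of_bool ((`) \<phi> ` rep_plgraph H \<subseteq> F)))"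
        using F by (intro sum.cong refl arg_cong2[where f = "(*)"])
          (simp add: sum_distrib_left[symmetric] of_bool_def sum.delta)
      also have "\<dots> = (\<Sum>H\<in>?K. ?c H * blend v D F 1 (rep_plgraph H))"
        by (simp add: blend_at_1 D maps_def q_def)
      finally show ?thesis using zero by simp
    qed
    have "finite ((`) Some ` ?E0)" by (simp add: is_plgraph_finite)
    then have "g ((`) Some ` ?E0) = 0" using sums by (rule zero_of_subset_sums_zero[where g = g])
    moreover have "g ((`) Some ` ?E0) = ?c H0 * (\<Sum>\<phi>\<in>maps H0. q H0 * of_bool ((`) \<phi> ` ?E0 = (`) Some ` ?E0))"
    proof -
      have "?c H * (\<Sum>\<phi>\<in>maps H. q H * of_bool ((`) \<phi> ` rep_plgraph H = (`) Some ` ?E0)) = 0"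
        if H: "H \<in> ?K - {H0}" for H
      proof -
        have nl: "Lab n \<notin> \<Union>(rep_plgraph H)" "Lab n \<notin> \<Union>?E0" for n
          using assms(1) H H0(1) by (auto simp: unlabeled_comb_def unlabeled_def labels_rep)
        have "(`) \<phi> ` rep_plgraph H \<noteq> (`) Some ` ?E0" for \<phi>
        proof
          assume "(`) \<phi> ` rep_plgraph H = (`) Some ` ?E0"
          then have "plgraph_iso (rep_plgraph H) ?E0"
            using max[of H] H nl by (intro edge_surjection_iso) auto
          then have "H = H0" using abs_plgraph_eqI by fastforce
          then show False using H by simp
        qed
        then show ?thesis by simp
      qed
      then show ?thesis unfolding g_def
        by (subst sum.remove[OF _ H0(1)]) (auto intro!: sum.neutral simp del: mult_eq_0_iff)
    qed
    \<comment> \<open>The inclusion is one such map, and no term is negative.\<close>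
    moreover have "(\<Sum>\<phi>\<in>maps H0. q H0 * of_bool ((`) \<phi> ` ?E0 = (`) Some ` ?E0)) > 0"
    proof (rule sum_pos2[OF fin, of "restrict Some (\<Union>?E0)"])
      show "restrict Some (\<Union>?E0) \<in> maps H0" by (auto simp: maps_def D_def)
      have "restrict Some (\<Union>?E0) ` e = Some ` e" if "e \<in> ?E0" for e
        using that by (intro image_cong) auto
      then have "(`) (restrict Some (\<Union>?E0)) ` ?E0 = (`) Some ` ?E0" by (intro image_cong) auto
      moreover have "q H0 > 0" using D by (auto simp: q_def card_gt_0_iff)
      ultimately show "0 < q H0 * of_bool ((`) (restrict Some (\<Union>?E0)) ` ?E0 = (`) Some ` ?E0)" by simp
    qed (auto simp: q_def)
    ultimately show False using H0(1) by (simp add: in_keys_iff)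
  qed
qed

section \<open>Sos profiles\<close>

lemma eval_graph_cong:
  "(\<And>C. C \<in># components G \<Longrightarrow> v C = w C) \<Longrightarrow> eval_graph v G = eval_graph w G"
  unfolding eval_graph_def by (metis image_mset_cong)

lemma eval_comb_cong:
  assumes "\<And>G. G \<in> Poly_Mapping.keys a \<Longrightarrow> set_mset (components G) \<subseteq> V" "\<And>C. C \<in> V \<Longrightarrow> v C = w C"
  shows "eval_comb v a = eval_comb w a"
  unfolding eval_comb_def using assms
  by (intro sum.cong refl arg_cong2[where f = "(*)"] eval_graph_cong) blast

lemma eval_graph_nonneg: "(\<And>C. v C \<ge> 0) \<Longrightarrow> eval_graph v G \<ge> 0"
proof -
  assume "\<And>C. v C \<ge> 0"
  then have "(\<Prod>C\<in>#M. v C) \<ge> 0" for M by (induction M) auto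
  then show ?thesis by (simp add: eval_graph_def)
qed

lemma unlabel_square_components:
  assumes "label_bound l" "\<And>G. G \<in> Poly_Mapping.keys p \<Longrightarrow> num_edges G \<le> d"
    "H \<in> Poly_Mapping.keys (unlabel_comb (p\<^sup>2))"
  shows "set_mset (components H) \<subseteq> \<V> l d"
proof -
  obtain A B where AB: "A \<in> Poly_Mapping.keys p" "B \<in> Poly_Mapping.keys p" "H = unlabel (A + B)"
    using assms(3) by (rule keys_unlabel_square)
  then have "num_edges H \<le> 2 * d"
    using num_edges_add[of A B] assms(2)[of A] assms(2)[of B] by (simp add: num_edges_unlabel)
  then show ?thesis using components_subset_\<V>[OF assms(1)] AB(3) by simp
qed

text \<open>Evaluation is additive, so single squares suffice; \<open>blend_positive\<close> treats
  exactly one.\<close>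

lemma sos_profile_iff:
  "v \<in> sos_profile l d \<longleftrightarrow> v \<in> \<V> l d \<rightarrow>\<^sub>E {0..} \<and>
    (\<forall>p. (\<forall>G\<in>Poly_Mapping.keys p. num_edges G \<le> d) \<longrightarrow> eval_comb v (unlabel_comb (p\<^sup>2)) \<ge> 0)"
proof (intro iffI conjI allI impI)
  fix p :: graph_comb assume "v \<in> sos_profile l d" and p: "\<forall>G\<in>Poly_Mapping.keys p. num_edges G \<le> d"
  moreover have "is_sos d (unlabel_comb (p\<^sup>2))"
    unfolding is_sos_def by (rule exI[of _ "[p]"]) (use p in auto)
  ultimately show "eval_comb v (unlabel_comb (p\<^sup>2)) \<ge> 0" by (simp add: sos_profile_def)
next
  assume v: "v \<in> \<V> l d \<rightarrow>\<^sub>E {0..} \<and>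
    (\<forall>p. (\<forall>G\<in>Poly_Mapping.keys p. num_edges G \<le> d) \<longrightarrow> eval_comb v (unlabel_comb (p\<^sup>2)) \<ge> 0)"
  have "eval_comb v a \<ge> 0" if a: "is_sos d a" for a
  proof -
    obtain as where as: "\<And>a G. a \<in> set as \<Longrightarrow> G \<in> Poly_Mapping.keys a \<Longrightarrow> num_edges G \<le> d"
      "a = (\<Sum>a\<leftarrow>as. unlabel_comb (a\<^sup>2))"
      using a unfolding is_sos_def by blast
    show ?thesis unfolding as(2) eval_comb_sum_list
      by (rule sum_list_nonneg) (use v as(1) in auto)
  qed
  then show "v \<in> sos_profile l d" using v by (simp add: sos_profile_def)
qed (simp add: sos_profile_def)

text \<open>A square of level \<open>d\<close> is also one of level \<open>d'\<close>, and it
  involves only coordinates in \<open>\<V> l d\<close>, which by \<open>\<V>_mono\<close> are among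
  those of level \<open>d'\<close>.\<close>

lemma sos_profile_restrict:
  assumes l: "label_bound l" and v: "v \<in> sos_profile l d'" and "d \<le> d'"
  shows "restrict v (\<V> l d) \<in> sos_profile l d"
  unfolding sos_profile_iff
proof (intro conjI allI impI)
  show "restrict v (\<V> l d) \<in> \<V> l d \<rightarrow>\<^sub>E {0..}"
    using v \<V>_mono[OF l \<open>d \<le> d'\<close>] by (auto simp: sos_profile_def PiE_iff)
  fix p :: graph_comb assume p: "\<forall>G\<in>Poly_Mapping.keys p. num_edges G \<le> d"
  have "eval_comb (restrict v (\<V> l d)) (unlabel_comb (p\<^sup>2)) = eval_comb v (unlabel_comb (p\<^sup>2))"
    using p by (intro eval_comb_cong[where V = "\<V> l d"] unlabel_square_components[OF l]) auto
  moreover have "eval_comb v (unlabel_comb (p\<^sup>2)) \<ge> 0"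
    using v p \<open>d \<le> d'\<close> by (force simp: sos_profile_iff)
  ultimately show "eval_comb (restrict v (\<V> l d)) (unlabel_comb (p\<^sup>2)) \<ge> 0" by simp
qed

text \<open>\<open>b\<close> and \<open>c\<close> come with testing levels of their own; this moves
  both to a common larger level.\<close>

lemma sos_testable_eval_nonneg:
  assumes l: "label_bound l" and v: "v \<in> sos_profile l d'" and "d \<le> d'"
    and a: "\<And>G. G \<in> Poly_Mapping.keys a \<Longrightarrow> set_mset (components G) \<subseteq> \<V> l d"
    "\<And>v. v \<in> sos_profile l d \<Longrightarrow> eval_comb v a \<ge> 0"
  shows "eval_comb v a \<ge> 0"
proof -
  have "eval_comb (restrict v (\<V> l d)) a = eval_comb v a"
    by (rule eval_comb_cong[where V = "\<V> l d"]) (use a(1) in auto)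
  then show ?thesis using a(2)[OF sos_profile_restrict[OF l v \<open>d \<le> d'\<close>]] by simp
qed

lemma eval_graph_blend_profile:
  assumes G: "set_mset (components G) \<subseteq> V"
  shows "eval_graph (restrict (\<lambda>C. blend v D F s (rep_plgraph C)) V) G = blend v D F s (rep_plgraph G)"
proof -
  have "abs_plgraph C \<in> V" if "C \<in> edge_components (rep_plgraph G)" for C
    using G that plgraph_abs_simps(3)[OF is_plgraph_rep[of G]]
    by (auto simp: finite_edge_components)
  then show ?thesis
    using eval_graph_blend[OF is_plgraph_rep, of G "restrict (\<lambda>C. blend v D F s (rep_plgraph C)) V" v D F s]
    by simp
qed

text \<open>The new vector evaluates a product of two constituents to \<open>blend\<close> of their
  glued edge sets, which reduces the claim to \<open>blend_positive\<close>.\<close>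

lemma blend_in_sos_profile:
  assumes l: "label_bound l" and D: "finite D" "D \<noteq> {}" and s: "0 \<le> s" "s \<le> 1"
    and v: "\<And>C. v C \<ge> 0"
    "\<And>p. \<forall>G\<in>Poly_Mapping.keys p. num_edges G \<le> d \<Longrightarrow> eval_comb v (unlabel_comb (p\<^sup>2)) \<ge> 0"
  shows "restrict (\<lambda>C. blend v D F s (rep_plgraph C)) (\<V> l d) \<in> sos_profile l d" (is "?w \<in> _")
  unfolding sos_profile_iff
proof (intro conjI allI impI)
  have "blend v D F s E \<ge> 0" for E
    unfolding blend_def using s v(1)
    by (intro expec_nonneg)
       (auto simp: blend_weight_def map_density_def eval_graph_nonneg split: option.splits)
  then show "?w \<in> \<V> l d \<rightarrow>\<^sub>E {0..}" by auto
next
  fix p :: graph_comb assume p: "\<forall>G\<in>Poly_Mapping.keys p. num_edges G \<le> d"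
  let ?K = "Poly_Mapping.keys p" and ?c = "Poly_Mapping.lookup p"
  have "eval_graph ?w (unlabel (A + B)) = blend v D F s (glue (rep_plgraph A) (rep_plgraph B))"
    if "A \<in> ?K" "B \<in> ?K" for A B
  proof -
    let ?G = "glue (rep_plgraph A) (rep_plgraph B)"
    let ?E = "(`) drop_label ` ?G"
    have G: "is_plgraph ?G" by (simp add: is_plgraph_glue)
    have eq: "unlabel (A + B) = abs_plgraph ?E"
      using plgraph_abs_simps(1)[OF is_plgraph_rep[of A] is_plgraph_rep[of B]]
        plgraph_abs_simps(2)[OF G] by simp
    have "num_edges (unlabel (A + B)) \<le> 2 * d"
      using num_edges_add[of A B] bspec[OF p that(1)] bspec[OF p that(2)] by (simp add: num_edges_unlabel)
    then have "set_mset (components (unlabel (A + B))) \<subseteq> \<V> l d"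
      using components_subset_\<V>[OF l] by simp
    then have V: "abs_plgraph C \<in> \<V> l d" if "C \<in> edge_components ?E" for C
      using that plgraph_abs_simps(3)[OF is_plgraph_drop_label[OF G]] unfolding eq
      by (auto simp: finite_edge_components is_plgraph_drop_label[OF G])
    have "eval_graph ?w (abs_plgraph ?E) = blend v D F s ?E"
      by (rule eval_graph_blend) (use V is_plgraph_drop_label[OF G] in auto)
    also have "\<dots> = blend v D F s ?G"
      by (rule blend_image[OF G]) (auto simp: inj_on_def, metis drop_label_neq_Lab)
    finally show ?thesis unfolding eq .
  qed
  then have "eval_comb ?w (unlabel_comb ((\<Sum>G\<in>?K. Poly_Mapping.single G (?c G))\<^sup>2))
    = (\<Sum>A\<in>?K. \<Sum>B\<in>?K. ?c A * ?c B * blend v D F s (glue (rep_plgraph A) (rep_plgraph B)))"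
    by (subst eval_comb_unlabel_square) (auto intro!: sum.cong)
  also have "\<dots> \<ge> 0" by (rule blend_positive[OF D s v(2)]) (use p in auto)
  finally show "eval_comb ?w (unlabel_comb (p\<^sup>2)) \<ge> 0" by (simp only: sum_single_keys)
qed

text \<open>If \<open>p\<close> were negative at 0, it would be negative on an interval to the right
  of 0. There \<open>q\<close> has only finitely many roots, and at any other point of the interval
  within the unit interval \<open>q\<close> is positive, so the product has the wrong sign.\<close>

lemma poly_quotient_nonneg_at_0:
  fixes p q :: "real poly"
  assumes "q \<noteq> 0" and nonneg: "\<And>s. 0 \<le> s \<Longrightarrow> s \<le> 1 \<Longrightarrow> poly q s \<ge> 0 \<and> poly p s * poly q s \<ge> 0"
  shows "poly p 0 \<ge> 0"
proof (rule ccontr)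
  assume "\<not> poly p 0 \<ge> 0"
  then have neg: "poly p 0 < 0" by simp
  have "(poly p \<longlongrightarrow> poly p 0) (at_right 0)"
    by (rule tendsto_within_subset[OF isContD[OF poly_isCont]]) simp
  then have "eventually (\<lambda>s. poly p s < 0) (at_right 0)"
    using neg by (rule order_tendstoD(2))
  then obtain r where r: "r > 0" "\<And>s. s > 0 \<Longrightarrow> s < r \<Longrightarrow> poly p s < 0"
    unfolding eventually_at_right_field by blast
  have "infinite {0<..<min r 1}" using r(1) by (intro infinite_Ioo) simp
  moreover have "finite {s. poly q s = 0}" using assms(1) by (rule poly_roots_finite)
  ultimately have "{0<..<min r 1} - {s. poly q s = 0} \<noteq> {}"
    by (metis finite_Diff2 finite.emptyI)
  then obtain s where s: "0 < s" "s < min r 1" "poly q s \<noteq> 0" by force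
  then have "poly q s > 0" "poly p s < 0" "poly p s * poly q s \<ge> 0"
    using nonneg[of s] r(2)[of s] by auto
  then show False by (simp add: zero_le_mult_iff)
qed

theorem theorem4p16:
  fixes l :: "nat \<Rightarrow> nat" and a b c :: graph_comb
  assumes "label_bound l"
    and "unlabeled_comb a" and "unlabeled_comb b" and "unlabeled_comb c"
    and "b \<noteq> 0"
    and "sos_testable l b" and "sos_testable l c"
    and "a * b = c"
  shows "sos_testable l a"
proof -
  obtain db where b: "\<And>G. G \<in> Poly_Mapping.keys b \<Longrightarrow> set_mset (components G) \<subseteq> \<V> l db"
    "\<And>v. v \<in> sos_profile l db \<Longrightarrow> eval_comb v b \<ge> 0"
    using assms(6) unfolding sos_testable_def by blast
  obtain dc where c: "\<And>G. G \<in> Poly_Mapping.keys c \<Longrightarrow> set_mset (components G) \<subseteq> \<V> l dc"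
    "\<And>v. v \<in> sos_profile l dc \<Longrightarrow> eval_comb v c \<ge> 0"
    using assms(7) unfolding sos_testable_def by blast
  \<comment> \<open>The last summand bounds the edges of each constituent of \<open>a\<close>, so
    that \<open>a\<close> too is a polynomial in the coordinates of level \<open>d\<close>.\<close>
  define d where "d = db + dc + (\<Sum>G\<in>Poly_Mapping.keys a. num_edges G)"
  have le: "db \<le> d" "dc \<le> d" by (simp_all add: d_def)
  have aV: "set_mset (components G) \<subseteq> \<V> l d" if G: "G \<in> Poly_Mapping.keys a" for G
  proof (rule components_subset_\<V>[OF assms(1)])
    show "unlabeled G" using assms(2) G by (simp add: unlabeled_comb_def)
    have "num_edges G \<le> (\<Sum>G\<in>Poly_Mapping.keys a. num_edges G)"
      using G by (intro member_le_sum) auto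
    then show "num_edges G \<le> 2 * d" by (simp add: d_def)
  qed
  have bV: "set_mset (components G) \<subseteq> \<V> l d" if "G \<in> Poly_Mapping.keys b" for G
    using b(1)[OF that] \<V>_mono[OF assms(1) le(1)] by blast
  have "eval_comb v a \<ge> 0" if v: "v \<in> sos_profile l d" for v
  proof -
    \<comment> \<open>Outside \<open>\<V> l d\<close> the extensional \<open>v\<close> is
      \<open>undefined\<close>, a real of unknown sign. The default 0 gives the nonnegativity on all
      graphs that \<open>blend_in_sos_profile\<close> asks for.\<close>
    define v' where "v' C = (if C \<in> \<V> l d then v C else 0)" for C
    have v'0: "v' C \<ge> 0" for C using v by (auto simp: v'_def sos_profile_def)
    have v'pos: "eval_comb v' (unlabel_comb (p\<^sup>2)) \<ge> 0" if p: "\<forall>G\<in>Poly_Mapping.keys p. num_edges G \<le> d" for p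
    proof -
      have "eval_comb v' (unlabel_comb (p\<^sup>2)) = eval_comb v (unlabel_comb (p\<^sup>2))"
        using p by (intro eval_comb_cong[where V = "\<V> l d"] unlabel_square_components[OF assms(1)])
          (auto simp: v'_def)
      then show ?thesis using v p by (simp add: sos_profile_iff)
    qed
    obtain D F where D: "finite D" "D \<noteq> {}" and
      sep: "(\<Sum>H\<in>Poly_Mapping.keys b. Poly_Mapping.lookup b H * blend v' D F 1 (rep_plgraph H)) \<noteq> 0"
      using blend_separates[OF assms(3,5)] by blast
    obtain Q where Q: "\<And>E s. blend v' D F s E = poly (Q E) s"
      using blend_poly[of v' D F] by metis
    define w where "w s = restrict (\<lambda>C. blend v' D F s (rep_plgraph C)) (\<V> l d)" for s
    define P where "P a = (\<Sum>G\<in>Poly_Mapping.keys a. smult (Poly_Mapping.lookup a G) (Q (rep_plgraph G)))"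
      for a :: graph_comb
    have P: "eval_comb (w s) a = poly (P a) s"
      if "\<And>G. G \<in> Poly_Mapping.keys a \<Longrightarrow> set_mset (components G) \<subseteq> \<V> l d" for a s
      unfolding eval_comb_def P_def poly_sum w_def
      by (intro sum.cong refl) (simp only: eval_graph_blend_profile[OF that] Q[symmetric] poly_smult)
    have "poly (P b) 1 \<noteq> 0" using sep by (simp add: P_def poly_sum Q)
    then have "P b \<noteq> 0" by auto
    moreover have "poly (P b) s \<ge> 0 \<and> poly (P a) s * poly (P b) s \<ge> 0" if "0 \<le> s" "s \<le> 1" for s
    proof -
      have w: "w s \<in> sos_profile l d"
        unfolding w_def by (rule blend_in_sos_profile[OF assms(1) D that v'0 v'pos])
      have "eval_comb (w s) b \<ge> 0"
        by (rule sos_testable_eval_nonneg[OF assms(1) w le(1)]) (fact b)+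
      moreover have "eval_comb (w s) c \<ge> 0"
        by (rule sos_testable_eval_nonneg[OF assms(1) w le(2)]) (fact c)+
      moreover have "eval_comb (w s) c = eval_comb (w s) a * eval_comb (w s) b"
        using eval_comb_mult[OF assms(2,3)] assms(8) by simp
      ultimately show ?thesis using P[OF aV] P[OF bV] by simp
    qed
    ultimately have "poly (P a) 0 \<ge> 0" by (rule poly_quotient_nonneg_at_0)
    moreover have "poly (P a) 0 = eval_comb v' a"
    proof -
      have "blend v' D F 0 (rep_plgraph G) = eval_graph v' G" if "G \<in> Poly_Mapping.keys a" for G
        using that assms(2) by (simp add: blend_at_0 D unlabel_unlabeled unlabeled_comb_def)
      then show ?thesis by (simp add: P_def poly_sum Q[symmetric] eval_comb_def)
    qed
    moreover have "eval_comb v' a = eval_comb v a"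
      by (rule eval_comb_cong[OF aV]) (auto simp: v'_def)
    ultimately show ?thesis by simp
  qed
  then show ?thesis unfolding sos_testable_def using assms(2) aV by blast
qed

end
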